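(* Let $f \in C((0,\infty);(0,\infty))$ be asymptotically increasing with $\lim_{x\to\infty} f(x)/x = \infty$, let $w \in C([0,\infty);[0,\infty))$ with $w(0)>0$, and let $h \in C(\mathbb{R};\mathbb{R})$ satisfy $H(t) := \int_0^t h(s)\,ds \ge 0$ for each $t\ge 0$. Consider \[ x'(t) = h(t) + \int_0^t w(t-s) f(x(s))\,ds, \quad t \ge 0; \qquad x(0)=\psi>0. \] If \[ \int_\eta^\infty \frac{du}{\sqrt{\int_0^u f(s)\,ds}} < \infty \quad \text{for some } \eta>0, \] then solutions blow up in finite time. If in addition $f$ preserves superexponential growth and $f$ is increasing, then solutions satisfy \[ \lim_{t\to T^-} \frac{F_B(x(t))}{T-t} = \sqrt{2w(0)}, \] where $T$ is the blow-up time and $F_B(x) = \int_x^\infty \frac{du}{\sqrt{\int_0^u f(s)\,ds}}$ for $x>0$.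
   Context: "$f$ is asymptotically increasing" means that there is a continuous increasing function $\phi:(0,\infty)\to(0,\infty)$ with $f(x)/\phi(x)\to 1$ as $x\to\infty$. A function $g \in C((0,\infty);(0,\infty))$ exhibits superexponential growth if $g(x)\to\infty$ as $x\to\infty$ and $\lim_{x\to\infty} g(x-\epsilon)/g(x) = 0$ for each $\epsilon>0$. A function $\phi \in C((0,\infty);(0,\infty))$ preserves superexponential growth if for every $g$ exhibiting superexponential growth and every $\epsilon>0$, $\lim_{x\to\infty}\phi(g(x-\epsilon))/\phi(g(x)) = 0$. A solution blows up in finite time if there is $T>0$ with $x$ continuous on $[0,T)$ and $\lim_{t\to T^-}|x(t)|=\infty$; the minimal such $T$ is the blow-up time. *)

theory Defs
  imports "HOL-Analysis.Analysis"
begin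

definition asymp_increasing :: "(real \<Rightarrow> real) \<Rightarrow> bool" where
  "asymp_increasing f \<longleftrightarrow>
     (\<exists>\<phi>. continuous_on {0<..} \<phi> \<and> (\<forall>x>0. \<phi> x > 0) \<and> strict_mono_on {0<..} \<phi> \<and>
          ((\<lambda>x. f x / \<phi> x) \<longlongrightarrow> 1) at_top)"

definition superexp_growth :: "(real \<Rightarrow> real) \<Rightarrow> bool" where
  "superexp_growth g \<longleftrightarrow>
     continuous_on {0<..} g \<and> (\<forall>x>0. g x > 0) \<and> filterlim g at_top at_top \<and>
     (\<forall>\<epsilon>>0. ((\<lambda>x. g (x - \<epsilon>) / g x) \<longlongrightarrow> 0) at_top)"

definition preserves_superexp :: "(real \<Rightarrow> real) \<Rightarrow> bool" where
  "preserves_superexp \<phi> \<longleftrightarrow>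
     (\<forall>g. superexp_growth g \<longrightarrow>
        (\<forall>\<epsilon>>0. ((\<lambda>x. \<phi> (g (x - \<epsilon>)) / \<phi> (g x)) \<longlongrightarrow> 0) at_top))"

definition FB :: "(real \<Rightarrow> real) \<Rightarrow> real \<Rightarrow> real" where
  "FB f x = integral {x..} (\<lambda>u. 1 / sqrt (integral {0..u} f))"

definition is_solution ::
  "(real \<Rightarrow> real) \<Rightarrow> (real \<Rightarrow> real) \<Rightarrow> (real \<Rightarrow> real) \<Rightarrow> real \<Rightarrow> (real \<Rightarrow> real) \<Rightarrow> ereal \<Rightarrow> bool" where
  "is_solution h w f \<psi> x T \<longleftrightarrow>
     0 < T \<and> x 0 = \<psi> \<and> continuous_on {t. 0 \<le> t \<and> ereal t < T} x \<and>
     (\<forall>t. 0 \<le> t \<and> ereal t < T \<longrightarrow>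
        (x has_real_derivative (h t + integral {0..t} (\<lambda>s. w (t - s) * f (x s))))
          (at t within {t. 0 \<le> t \<and> ereal t < T}))"

definition is_maximal_solution ::
  "(real \<Rightarrow> real) \<Rightarrow> (real \<Rightarrow> real) \<Rightarrow> (real \<Rightarrow> real) \<Rightarrow> real \<Rightarrow> (real \<Rightarrow> real) \<Rightarrow> ereal \<Rightarrow> bool" where
  "is_maximal_solution h w f \<psi> x T \<longleftrightarrow>
     is_solution h w f \<psi> x T \<and>
     \<not> (\<exists>y T'. T < T' \<and> is_solution h w f \<psi> y T' \<and> (\<forall>t. 0 \<le> t \<and> ereal t < T \<longrightarrow> y t = x t))"

end

theory Submission
  imports Defs "HOL-Complex_Analysis.Great_Picard"
begin

text \<open>
  Write \<open>H t = \<integral>\<^sub>0\<^sup>t h\<close>, \<open>F u = \<integral>\<^sub>0\<^sup>u f\<close> and \<open>y = x - H\<close>, so that \<open>y' t = \<integral>\<^sub>0\<^sup>t w (t - s) f (x s) ds \<ge> 0\<close>.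
  The solution cannot be global: once \<open>y\<close> has reached a large level \<open>A\<close>, it doubles within a time
  comparable to \<open>\<integral> du / sqrt (F u)\<close> over \<open>[A / 2, A]\<close>, and these times have a finite sum. If \<open>T\<close> is
  finite, then \<open>y\<close> is unbounded, since otherwise \<open>x\<close> has a limit at \<open>T\<close> and a Peano type theorem extends
  it. As \<open>y\<close> is nondecreasing, \<open>x\<close> tends to infinity at \<open>T\<close>.

  For the rate, put \<open>I t = \<integral>\<^sub>0\<^sup>t f (x s) ds\<close>. It diverges at the finite time \<open>T\<close>, so only the values of \<open>w\<close>
  near \<open>0\<close> matter and \<open>x' / I\<close> tends to \<open>w 0\<close>. L'Hopital's rule gives that \<open>I\<^sup>2 / F (x)\<close> tends to
  \<open>2 / w 0\<close>, because the quotient of the derivatives is \<open>2 I / x'\<close>. Hence \<open>x' / sqrt (F (x))\<close> tends to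
  \<open>sqrt (2 w 0)\<close>, and a second use of L'Hopital's rule gives the claim.
\<close>

section \<open>Convolutions and integrals\<close>

text \<open>The memory term of the equation; for \<open>t < 0\<close> the domain is empty and the
  value is 0.\<close>

definition conv :: "(real \<Rightarrow> real) \<Rightarrow> (real \<Rightarrow> real) \<Rightarrow> real \<Rightarrow> real" where
  "conv w q t = integral {0..t} (\<lambda>s. w (t - s) * q s)"

lemma conv_cong: "(\<And>s. s \<in> {0..t} \<Longrightarrow> q s = q' s) \<Longrightarrow> conv w q t = conv w q' t"
  unfolding conv_def by (rule integral_cong) simp

text \<open>The bound \<open>b \<le> t\<close> keeps \<open>t - s\<close> in \<open>{0..}\<close>,
  where \<open>w\<close> is continuous.\<close>

lemma conv_integrand_continuous:
  fixes w q :: "real \<Rightarrow> real"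
  assumes "continuous_on {0..} w" "continuous_on {a..b} q" "b \<le> t"
  shows "continuous_on {a..b} (\<lambda>s. w (t - s) * q s)"
proof (rule continuous_on_mult)
  show "continuous_on {a..b} (\<lambda>s. w (t - s))"
    by (rule continuous_on_compose2[OF assms(1)]) (use assms(3) in \<open>auto intro!: continuous_intros\<close>)
qed (fact assms(2))

lemma conv_continuous:
  assumes w: "continuous_on {0..} w" and q: "continuous_on {0..b} q"
  shows "continuous_on {0..b} (conv w q)"
proof -
  \<comment> \<open>Substituting \<open>s = r u\<close> moves the parameter from the domain of integration to the integrand.\<close>
  have eq: "conv w q r = r * integral (cbox 0 1) (\<lambda>u. w (r - r * u) * q (r * u))"
    if "r \<in> {0..b}" for r
  proof (cases "r = 0")
    case False
    then have "r > 0" using that by simp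
    then have "(\<lambda>x. x / r) ` {0..r} = {0..1}"
      by (simp add: image_divide_atLeastAtMost)
    then show ?thesis
      using integral_stretch_real[of r 0 r "\<lambda>s. w (r - s) * q s"] \<open>r > 0\<close>
      by (simp add: conv_def)
  qed (simp add: conv_def)
  have "continuous_on ({0..b} \<times> cbox 0 1) (\<lambda>(r,u). w (r - r * u) * q (r * u))"
    unfolding case_prod_unfold
  proof (intro continuous_on_mult continuous_on_compose2[OF w] continuous_on_compose2[OF q])
    show "(\<lambda>x. fst x - fst x * snd x) ` ({0..b} \<times> cbox (0::real) 1) \<subseteq> {0..}"
      by (auto simp: mult_left_le)
    show "(\<lambda>x. fst x * snd x) ` ({0..b} \<times> cbox (0::real) 1) \<subseteq> {0..b}"
    proof (rule image_subsetI)
      fix p :: "real \<times> real" assume "p \<in> {0..b} \<times> cbox 0 1"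
      then have "0 \<le> fst p * snd p" "fst p * snd p \<le> fst p" "fst p \<le> b"
        by (auto simp: mult_left_le)
      then show "fst p * snd p \<in> {0..b}" by simp
    qed
  qed (intro continuous_intros)+
  then have "continuous_on {0..b} (\<lambda>r. r * integral (cbox 0 1) (\<lambda>u. w (r - r * u) * q (r * u)))"
    by (rule continuous_on_mult[OF continuous_on_id integral_continuous_on_param])
  then show ?thesis
    by (subst continuous_on_cong[OF refl eq])
qed

text \<open>Comparison form of the mean value theorem. It asks for derivatives only inside the
  interval, since solutions are differentiated there, and for continuity up to the ends.\<close>

lemma increment_le:
  fixes u v :: "real \<Rightarrow> real"
  assumes "a \<le> b" "continuous_on {a..b} u" "continuous_on {a..b} v"
    and "\<And>t. a < t \<Longrightarrow> t < b \<Longrightarrow> (u has_real_derivative u' t) (at t)"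
    and "\<And>t. a < t \<Longrightarrow> t < b \<Longrightarrow> (v has_real_derivative v' t) (at t)"
    and "\<And>t. a < t \<Longrightarrow> t < b \<Longrightarrow> u' t \<le> v' t"
  shows "u b - u a \<le> v b - v a"
proof -
  have "(\<lambda>t. v t - u t) a \<le> (\<lambda>t. v t - u t) b"
  proof (rule DERIV_nonneg_imp_increasing_open[OF \<open>a \<le> b\<close>])
    show "\<exists>y. ((\<lambda>t. v t - u t) has_real_derivative y) (at t) \<and> 0 \<le> y" if "a < t" "t < b" for t
      using assms(4-6)[OF that] by (intro exI[of _ "v' t - u' t"]) (auto intro!: derivative_intros)
  qed (intro continuous_intros assms)
  then show ?thesis by simp
qed

text \<open>The integrand may be singular at 0. The fundamental theorem is therefore applied from an
  interior base point \<open>a\<close>, and the integral over \<open>{0..a}\<close> is a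
  constant.\<close>

lemma integral_atLeastAtMost_has_real_derivative:
  fixes q :: "real \<Rightarrow> real"
  assumes "q integrable_on {0..b}" "continuous_on {0<..<b} q" "0 < t" "t < b"
  shows "((\<lambda>u. integral {0..u} q) has_real_derivative q t) (at t)"
proof -
  define a c where "a = t / 2" and "c = (t + b) / 2"
  have ac: "0 < a" "a < t" "t < c" "c < b"
    using assms by (auto simp: a_def c_def)
  have "continuous_on {a..c} q"
    using continuous_on_subset[OF assms(2)] ac by (auto simp: subset_eq)
  then have "((\<lambda>u. integral {a..u} q) has_real_derivative q t) (at t within {a..c})"
    using ac by (intro integral_has_real_derivative) auto
  then have "((\<lambda>u. integral {0..a} q + integral {a..u} q) has_real_derivative q t) (at t within {a..c})"
    by (auto intro!: derivative_eq_intros)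
  then have "((\<lambda>u. integral {0..a} q + integral {a..u} q) has_real_derivative q t) (at t)"
    using at_within_Icc_at[of a t c] ac by simp
  moreover have "integral {0..a} q + integral {a..u} q = integral {0..u} q" if "u \<in> {a<..<c}" for u
    using that ac
    by (intro Henstock_Kurzweil_Integration.integral_combine integrable_subinterval_real[OF assms(1)]) auto
  ultimately show ?thesis
    using ac by (elim has_field_derivative_transform_within_open[where S = "{a<..<c}"]) auto
qed

section \<open>Tails of improper integrals\<close>

lemma has_integral_tail:
  fixes k :: "real \<Rightarrow> real"
  assumes int: "k integrable_on {a..}" and "a \<le> x"
  shows "(k has_integral (integral {a..} k - integral {a..x} k)) {x..}"
proof -
  have "k integrable_on {a..x}"
    using integrable_on_subcbox[OF int, of a x] by simp
  then have "((\<lambda>y. (if y \<in> {a..} then k y else 0) - (if y \<in> {a..x} then k y else 0)) has_integral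
      (integral {a..} k - integral {a..x} k)) UNIV"
    by (intro has_integral_diff)
      (simp_all only: has_integral_restrict_UNIV integrable_integral[OF int] integrable_integral)
  then have "((\<lambda>y. if y \<in> {x..} then k y else 0) has_integral
      (integral {a..} k - integral {a..x} k)) UNIV"
    \<comment> \<open>The difference of the two zero extensions agrees with the extension from
      \<open>{x..}\<close> except at the single point \<open>x\<close>.\<close>
    by (rule has_integral_spike[of "{x}" UNIV, rotated 2]) (use \<open>a \<le> x\<close> in auto)
  then show ?thesis unfolding has_integral_restrict_UNIV .
qed

text \<open>Integrals over large boxes approach the improper integral. For large \<open>x\<close>
  the box \<open>{-x..x}\<close> meets \<open>{a..}\<close> in \<open>{a..x}\<close>, so the tail is
  the error of this approximation.\<close>

lemma integral_tail_tendsto_0: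
  fixes k :: "real \<Rightarrow> real"
  assumes int: "k integrable_on {a..}"
  shows "((\<lambda>x. integral {x..} k) \<longlongrightarrow> 0) at_top"
proof (rule tendstoI)
  fix e :: real assume "e > 0"
  obtain B where B: "B > 0" "\<And>c d. ball 0 B \<subseteq> cbox c d \<Longrightarrow>
      norm (integral (cbox c d) (\<lambda>x. if x \<in> {a..} then k x else 0) - integral {a..} k) < e"
    using int[THEN integrable_integral, unfolded has_integral_alt'] \<open>e > 0\<close> by meson
  have "dist (integral {x..} k) 0 < e" if x: "x \<ge> max B (\<bar>a\<bar> + 1)" for x
  proof -
    have "ball 0 B \<subseteq> cbox (-x) x" using x by (auto simp: dist_real_def)
    from B(2)[OF this] have "norm (integral {-x..x} (\<lambda>y. if y \<in> {a..} then k y else 0) - integral {a..} k) < e"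
      by simp
    moreover have "integral {-x..x} (\<lambda>y. if y \<in> {a..} then k y else 0) = integral {a..x} k"
    proof -
      have "{a..} \<inter> {-x..x} = {a..x}" using x by auto
      then show ?thesis by (simp only: integral_restrict_Int)
    qed
    moreover have "integral {x..} k = integral {a..} k - integral {a..x} k"
      using x by (intro integral_unique has_integral_tail[OF int]) auto
    ultimately show ?thesis by simp
  qed
  then show "\<forall>\<^sub>F x in at_top. dist (integral {x..} k) 0 < e"
    unfolding eventually_at_top_linorder by blast
qed

section \<open>Continuation of solutions of Volterra equations\<close>

text \<open>Tonelli's delayed approximations: the \<open>n\<close>-th one evaluates the unknown function at
  \<open>d n s\<close>, which lags behind \<open>s\<close> by \<open>1 / (n + 1)\<close> once \<open>s\<close> is beyond \<open>a\<close>, so that finitely many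
  iterations determine it on \<open>[0, a + 1]\<close>.\<close>
lemma volterra_continuation:
  fixes h w g x :: "real \<Rightarrow> real"
  assumes a: "a \<ge> 0" and w: "continuous_on {0..} w" and h: "continuous_on {0..a + 1} h"
    and g: "continuous_on UNIV g" "\<And>u. \<bar>g u\<bar> \<le> B"
    and x: "continuous_on {0..a} x"
      "\<And>t. t \<in> {0..a} \<Longrightarrow> x t = p + integral {0..t} (\<lambda>r. h r + conv w (\<lambda>s. g (x s)) r)"
  obtains z where "continuous_on {0..a + 1} z"
    "\<And>t. t \<in> {0..a + 1} \<Longrightarrow> z t = p + integral {0..t} (\<lambda>r. h r + conv w (\<lambda>s. g (z s)) r)"
    "\<And>t. t \<in> {0..a} \<Longrightarrow> z t = x t"
proof -
  define S where "S = {0..a + 1}"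
  define rhs where "rhs q t = p + integral {0..t} (\<lambda>r. h r + conv w q r)" for q t
  define d where "d n s = min s (max a (s - 1 / real (Suc n)))" for n s
  define \<Phi> where "\<Phi> n v = rhs (\<lambda>s. g (v (d n s)))" for n v
  \<comment> \<open>The iteration starts from \<open>x\<close> frozen at its value at
    \<open>a\<close>. Step \<open>j\<close> settles the values up to \<open>a + j / (n + 1)\<close>,
    so the \<open>n + 1\<close> steps used in \<open>z\<close> reach \<open>a + 1\<close>.\<close>
  define v where "v n j = (\<Phi> n ^^ j) (\<lambda>t. x (min t a))" for n j
  define z where "z n = v n (Suc n)" for n
  define q where "q n s = g (z n (d n s))" for n s
  have v_Suc: "v n (Suc j) = \<Phi> n (v n j)" for n j by (simp add: v_def)
  have d: "d n s \<in> S" "d n s \<le> s" "s - d n s \<le> 1 / real (Suc n)" if "s \<in> S" for n s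
    using that a by (auto simp: d_def S_def min_def max_def)
  have d_id: "d n s = s" if "s \<le> a" for n s
    using that by (simp add: d_def min_absorb1 le_max_iff_disj)
  have d_cont: "continuous_on S (d n)" for n
    unfolding d_def by (intro continuous_intros)
  have rhs_cong: "rhs q t = rhs q' t" if "\<And>s. s \<in> {0..t} \<Longrightarrow> q s = q' s" for q q' t
    unfolding rhs_def using that by (intro arg_cong2[where f = "(+)"] refl integral_cong conv_cong) auto

  have integrand_cont: "continuous_on {0..t} (\<lambda>r. h r + conv w q r)" if "continuous_on S q" "t \<in> S" for q t
    using that unfolding S_def
    by (intro continuous_on_add continuous_on_subset[OF h] conv_continuous[OF w])
      (auto elim: continuous_on_subset)
  have rhs_cont: "continuous_on S (rhs q)" if "continuous_on S q" for q
  proof -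
    have "a + 1 \<in> S" using a by (simp add: S_def)
    from integrand_cont[OF that this] show ?thesis
      unfolding rhs_def S_def
      by (rule continuous_on_add[OF continuous_on_const
            indefinite_integral_continuous_1[OF integrable_continuous_real]])
  qed
  have delay_cont: "continuous_on S (\<lambda>s. g (u (d n s)))" if "continuous_on S u" for u n
    by (rule continuous_on_compose2[OF g(1) continuous_on_compose2[OF that d_cont]]) (use d in auto)
  have v_cont: "continuous_on S (v n j)" for n j
  proof (induction j)
    case 0
    show ?case unfolding v_def S_def
      by (auto intro!: continuous_on_compose2[OF x(1)] continuous_intros simp: a)
  next
    case (Suc j)
    then show ?case unfolding v_Suc \<Phi>_def by (intro rhs_cont delay_cont)
  qed
  then have q_cont: "continuous_on S (q n)" for n
    unfolding q_def z_def by (intro delay_cont)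

  have agree: "v n (Suc j) t = v n j t" if "t \<in> S" "t \<le> a + real j / real (Suc n)" for n j t
    using that
  proof (induction j arbitrary: t)
    case 0
    then have "\<Phi> n (\<lambda>t. x (min t a)) t = rhs (\<lambda>s. g (x s)) t"
      unfolding \<Phi>_def by (intro rhs_cong) (auto simp: d_id)
    then show ?case using 0 x(2)[of t] by (simp add: v_def rhs_def S_def)
  next
    case (Suc j)
    \<comment> \<open>The right-hand side at \<open>t\<close> sees the unknown only at
      \<open>d n s\<close>, which lies in the range settled one step earlier.\<close>
    have "v n (Suc j) (d n s) = v n j (d n s)" if s: "s \<in> {0..t}" for s
    proof (rule Suc.IH)
      show "d n s \<in> S" using d(1)[of s] s Suc.prems(1) by (auto simp: S_def)
      have "d n s \<le> max a (s - 1 / real (Suc n))" by (simp add: d_def)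
      also have "\<dots> \<le> a + real j / real (Suc n)"
        using s Suc.prems(2) by (auto simp: add_divide_distrib)
      finally show "d n s \<le> a + real j / real (Suc n)" .
    qed
    then show ?case
      unfolding v_Suc[of n "Suc j"] v_Suc[of n j] \<Phi>_def
      by (intro rhs_cong) (simp only: v_Suc[symmetric])
  qed
  have z_eq: "z n t = rhs (q n) t" if "t \<in> S" for n t
    using agree[of t "Suc n" n] that unfolding z_def v_Suc[of n "Suc n"] \<Phi>_def q_def by (simp add: S_def)
  have z_x: "z n t = x t" if t: "t \<in> {0..a}" for n t
  proof -
    have "v n j t = x t" for j
    proof (induction j)
      case (Suc j)
      have "t \<in> S" using t by (simp add: S_def)
      moreover have "t \<le> a + real j / real (Suc n)"
        using t by (intro add_increasing2 divide_nonneg_nonneg) auto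
      ultimately have "v n (Suc j) t = v n j t" by (rule agree)
      then show ?case using Suc by simp
    qed (use t in \<open>simp add: v_def\<close>)
    then show ?thesis by (simp add: z_def)
  qed

  have "compact (w ` S)" "compact (h ` S)"
    unfolding S_def by (auto intro!: compact_continuous_image continuous_on_subset[OF w] h)
  then obtain W M where W: "\<And>s. s \<in> S \<Longrightarrow> \<bar>w s\<bar> \<le> W" and M: "\<And>s. s \<in> S \<Longrightarrow> \<bar>h s\<bar> \<le> M"
    by (metis compact_imp_bounded bounded_pos image_eqI real_norm_def)
  have "0 \<in> S" using a by (simp add: S_def)
  then have W0: "W \<ge> 0" and M0: "M \<ge> 0" and B0: "B \<ge> 0"
    using W[of 0] M[of 0] g(2)[of 0] by linarith+
  have wq_bound: "\<bar>w (r - s) * q n s\<bar> \<le> W * B" if "r \<in> S" "s \<in> {0..r}" for n r s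
    using that W[of "r - s"] g(2) W0 by (auto simp: abs_mult S_def q_def intro!: mult_mono)
  have wq_int: "(\<lambda>s. w (r - s) * q n s) integrable_on {0..r}" if "r \<in> S" for n r
    using that by (intro integrable_continuous_real conv_integrand_continuous[OF w]
        continuous_on_subset[OF q_cont]) (auto simp: S_def)
  \<comment> \<open>A bound for the derivatives of all \<open>z n\<close> that does not depend on
    \<open>n\<close>.\<close>
  define L where "L = M + W * B * (a + 1)"
  have bound: "\<bar>h r + conv w (q n) r\<bar> \<le> L" if r: "r \<in> S" for n r
  proof -
    have "norm (conv w (q n) r) \<le> integral {0..r} (\<lambda>_. W * B)"
      unfolding conv_def
      by (rule integral_norm_bound_integral) (use wq_int[OF r] wq_bound[OF r] in auto)
    also have "\<dots> = r * (W * B)" using r by (simp add: S_def)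
    also have "\<dots> \<le> (a + 1) * (W * B)"
      using r W0 B0 by (intro mult_right_mono) (auto simp: S_def)
    finally show ?thesis using M[OF r] by (simp add: L_def algebra_simps)
  qed
  have L0: "L \<ge> 0" using bound[OF \<open>0 \<in> S\<close>] by fastforce
  have z_lip: "\<bar>z n t - z n s\<bar> \<le> L * (t - s)" if "s \<in> S" "t \<in> S" "s \<le> t" for n s t
  proof -
    have int: "(\<lambda>r. h r + conv w (q n) r) integrable_on {0..t}"
      by (intro integrable_continuous_real integrand_cont q_cont that)
    have "z n t - z n s = integral {s..t} (\<lambda>r. h r + conv w (q n) r)"
      unfolding z_eq[OF that(1)] z_eq[OF that(2)] rhs_def
      using Henstock_Kurzweil_Integration.integral_combine[OF _ that(3) int] that by (simp add: S_def)
    moreover have "norm (integral {s..t} (\<lambda>r. h r + conv w (q n) r)) \<le> integral {s..t} (\<lambda>_. L)"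
      using that bound
      by (intro integral_norm_bound_integral integrable_subinterval_real[OF int]) (auto simp: S_def)
    ultimately show ?thesis using that by (simp add: mult.commute)
  qed
  have z_lip': "\<bar>z n t - z n s\<bar> \<le> L * \<bar>t - s\<bar>" if "s \<in> S" "t \<in> S" for n s t
    using z_lip[of s t n] z_lip[of t s n] that by (cases "s \<le> t") (auto simp: abs_minus_commute)

  \<comment> \<open>Arzela-Ascoli: since \<open>z n 0 = p\<close>, the common Lipschitz constant
    \<open>L\<close> gives both uniform boundedness and equicontinuity.\<close>
  obtain y \<kappa> where y: "continuous_on S y" "strict_mono (\<kappa> :: nat \<Rightarrow> nat)"
      "\<And>e. 0 < e \<Longrightarrow> \<exists>N. \<forall>n x. n \<ge> N \<and> x \<in> S \<longrightarrow> norm (z (\<kappa> n) x - y x) < e"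
  proof (rule Arzela_Ascoli[of S z "\<bar>p\<bar> + L * (a + 1)"])
    show "compact S" by (simp add: S_def)
    show "norm (z n t) \<le> \<bar>p\<bar> + L * (a + 1)" if "t \<in> S" for n t
    proof -
      have "z n 0 = p" using z_eq[OF \<open>0 \<in> S\<close>] by (simp add: rhs_def)
      moreover have "L * t \<le> L * (a + 1)" using that L0 by (intro mult_left_mono) (auto simp: S_def)
      ultimately show ?thesis using z_lip'[OF \<open>0 \<in> S\<close> that, of n] that by (auto simp: S_def)
    qed
    show "\<exists>d>0. \<forall>n y. y \<in> S \<and> norm (t - y) < d \<longrightarrow> norm (z n t - z n y) < e" if t: "t \<in> S" "0 < e" for t e
    \<comment> \<open>\<open>L + 1\<close> replaces \<open>L\<close> because \<open>L\<close> may be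
      0.\<close>
    proof (intro exI[of _ "e / (L + 1)"] conjI allI impI)
      fix n s assume s: "s \<in> S \<and> norm (t - s) < e / (L + 1)"
      have "\<bar>z n t - z n s\<bar> \<le> L * \<bar>t - s\<bar>" using z_lip' s t by blast
      also have "\<dots> \<le> (L + 1) * \<bar>t - s\<bar>" by (simp add: mult_right_mono)
      also have "\<dots> < e" using s L0 by (simp add: field_simps)
      finally show "norm (z n t - z n s) < e" by simp
    qed (use t L0 in simp)
  qed blast
  have lim: "(\<lambda>n. z (\<kappa> n) t) \<longlonglongrightarrow> y t" if "t \<in> S" for t
    unfolding LIMSEQ_iff using y(3) that by blast
  have delay_lim: "(\<lambda>n. z (\<kappa> n) (d (\<kappa> n) s)) \<longlonglongrightarrow> y s" if s: "s \<in> S" for s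
  proof -
    \<comment> \<open>The delay is at most \<open>1 / (n + 1)\<close>, so by the Lipschitz bound it
      disappears in the limit.\<close>
    have "(\<lambda>n. z (\<kappa> n) (d (\<kappa> n) s) - z (\<kappa> n) s) \<longlonglongrightarrow> 0"
    proof (rule Lim_null_comparison)
      show "\<forall>\<^sub>F n in sequentially. norm (z (\<kappa> n) (d (\<kappa> n) s) - z (\<kappa> n) s) \<le> L * (1 / real (Suc (\<kappa> n)))"
      proof (intro always_eventually allI)
        fix n
        have "\<bar>z (\<kappa> n) (d (\<kappa> n) s) - z (\<kappa> n) s\<bar> \<le> L * \<bar>d (\<kappa> n) s - s\<bar>"
          using z_lip' d(1) s by blast
        also have "\<dots> \<le> L * (1 / real (Suc (\<kappa> n)))"
          using d(2,3)[OF s, of "\<kappa> n"] L0 by (intro mult_left_mono) auto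
        finally show "norm (z (\<kappa> n) (d (\<kappa> n) s) - z (\<kappa> n) s) \<le> L * (1 / real (Suc (\<kappa> n)))" by simp
      qed
      have "(\<lambda>n. 1 / real (Suc (\<kappa> n))) \<longlonglongrightarrow> 0"
        using LIMSEQ_subseq_LIMSEQ[OF lim_1_over_n[THEN LIMSEQ_Suc] y(2)] by (simp add: o_def)
      then show "(\<lambda>n. L * (1 / real (Suc (\<kappa> n)))) \<longlonglongrightarrow> 0" by (rule tendsto_mult_right_zero)
    qed
    from tendsto_add[OF this lim[OF s]] show ?thesis by simp
  qed
  have q_lim: "(\<lambda>n. q (\<kappa> n) s) \<longlonglongrightarrow> g (y s)" if "s \<in> S" for s
    unfolding q_def using g(1) delay_lim[OF that]
    by (intro continuous_on_tendsto_compose[OF g(1)]) auto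
  \<comment> \<open>Dominated convergence is used twice, here for the memory integral and then for
    the outer integral in \<open>rhs\<close>.\<close>
  have conv_lim: "(\<lambda>n. conv w (q (\<kappa> n)) r) \<longlonglongrightarrow> conv w (\<lambda>s. g (y s)) r" if r: "r \<in> S" for r
    unfolding conv_def
  proof (rule dominated_convergence(2)[where h = "\<lambda>_. W * B"])
    show "(\<lambda>n. w (r - s) * q (\<kappa> n) s) \<longlonglongrightarrow> w (r - s) * g (y s)" if "s \<in> {0..r}" for s
      using that r by (intro tendsto_intros q_lim) (auto simp: S_def)
  qed (use wq_int[OF r] wq_bound[OF r] in auto)
  have rhs_lim: "(\<lambda>n. rhs (q (\<kappa> n)) t) \<longlonglongrightarrow> rhs (\<lambda>s. g (y s)) t" if t: "t \<in> S" for t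
    unfolding rhs_def
  proof (rule tendsto_add[OF tendsto_const dominated_convergence(2)[where h = "\<lambda>_. L"]])
    show "(\<lambda>n. h r + conv w (q (\<kappa> n)) r) \<longlonglongrightarrow> h r + conv w (\<lambda>s. g (y s)) r" if "r \<in> {0..t}" for r
      using that t by (intro tendsto_intros conv_lim) (auto simp: S_def)
    show "norm (h r + conv w (q (\<kappa> n)) r) \<le> L" if "r \<in> {0..t}" for n r
      using that t bound[of r] by (auto simp: S_def)
    show "(\<lambda>r. h r + conv w (q (\<kappa> n)) r) integrable_on {0..t}" for n
      by (intro integrable_continuous_real integrand_cont q_cont t)
  qed auto
  show thesis
  proof
    show "continuous_on {0..a + 1} y" using y(1) by (simp add: S_def)
    show "y t = p + integral {0..t} (\<lambda>r. h r + conv w (\<lambda>s. g (y s)) r)" if "t \<in> {0..a + 1}" for t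
    proof -
      have t: "t \<in> S" using that by (simp add: S_def)
      have "(\<lambda>n. z (\<kappa> n) t) \<longlonglongrightarrow> rhs (\<lambda>s. g (y s)) t"
        using rhs_lim[OF t] by (simp add: z_eq[OF t])
      then show ?thesis using LIMSEQ_unique[OF lim[OF t]] by (simp add: rhs_def)
    qed
    show "y t = x t" if "t \<in> {0..a}" for t
      using LIMSEQ_unique[OF lim[of t]] z_x[OF that] that by (simp add: S_def)
  qed
qed

section \<open>The Osgood integral\<close>

text \<open>Collects what concerns \<open>f\<close> alone. As \<open>f\<close> may be singular at 0,
  integrability up to 0 is an assumption of its own.\<close>

locale osgood =
  fixes f :: "real \<Rightarrow> real"
  assumes f_cont: "continuous_on {0<..} f"
    and f_pos: "u > 0 \<Longrightarrow> f u > 0"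
    and f_superlin: "filterlim (\<lambda>u. f u / u) at_top at_top"
    and f_int: "u > 0 \<Longrightarrow> f integrable_on {0..u}"
    and osgood: "\<exists>\<eta>>0. (\<lambda>u. 1 / sqrt (integral {0..u} f)) integrable_on {\<eta>..}"
begin

section \<open>The primitive of \<open>f\<close>\<close>

abbreviation F :: "real \<Rightarrow> real" where
  "F u \<equiv> integral {0..u} f"

lemma F_continuous: "continuous_on {0..b} F"
proof (cases "b > 0")
  case True
  then show ?thesis by (intro indefinite_integral_continuous_1 f_int)
next
  case False
  then have "{0..b} = {} \<or> {0..b} = {0}" by auto
  then show ?thesis by auto
qed

lemma F_deriv: "u > 0 \<Longrightarrow> (F has_real_derivative f u) (at u)"
  by (rule integral_atLeastAtMost_has_real_derivative[of f "u + 1"])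
    (auto intro: f_int continuous_on_subset[OF f_cont])

lemma F_strict_mono: "0 \<le> a \<Longrightarrow> a < b \<Longrightarrow> F a < F b"
  by (rule DERIV_pos_imp_increasing_open)
    (auto intro!: exI F_deriv f_pos continuous_on_subset[OF F_continuous[of b]])

lemma F_pos: "u > 0 \<Longrightarrow> F u > 0"
  using F_strict_mono[of 0 u] by simp

lemma F_mono: "0 \<le> a \<Longrightarrow> a \<le> b \<Longrightarrow> F a \<le> F b"
  using F_strict_mono[of a b] by (cases "a = b") auto

lemma f_eventually_ge: "\<exists>K>0. \<forall>u\<ge>K. f u \<ge> 1"
proof -
  have "\<forall>\<^sub>F u in at_top. 1 \<le> f u / u"
    using f_superlin by (simp add: filterlim_at_top)
  then obtain K where K: "\<And>u. u \<ge> K \<Longrightarrow> 1 \<le> f u / u"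
    by (auto simp: eventually_at_top_linorder)
  have "f u \<ge> 1" if "u \<ge> max K 1" for u
    using K[of u] that by (simp add: field_simps)
  then show ?thesis by (intro exI[of _ "max K 1"]) auto
qed

text \<open>On the compact interval \<open>{a..a + K}\<close> the minimum of \<open>f\<close> is
  attained and positive; beyond it superlinear growth gives \<open>f u \<ge> 1\<close>.\<close>

lemma f_lower_bound:
  assumes "a > 0"
  shows "\<exists>m>0. \<forall>u\<ge>a. f u \<ge> m"
proof -
  obtain K where K: "K > 0" "\<And>u. u \<ge> K \<Longrightarrow> f u \<ge> 1" using f_eventually_ge by blast
  have "continuous_on {a..a + K} f"
    using assms by (intro continuous_on_subset[OF f_cont]) auto
  then obtain v where v: "v \<in> {a..a + K}" "\<And>u. u \<in> {a..a + K} \<Longrightarrow> f v \<le> f u"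
    using continuous_attains_inf[of "{a..a + K}" f] \<open>K > 0\<close> by force
  have "f u \<ge> min (f v) 1" if "u \<ge> a" for u
    using v(2)[of u] K(2)[of u] that assms by (cases "u \<le> a + K") auto
  moreover have "min (f v) 1 > 0" using f_pos[of v] v(1) assms by auto
  ultimately show ?thesis by blast
qed

lemma F_at_top: "filterlim F at_top at_top"
proof -
  obtain K where K: "K > 0" "\<And>u. u \<ge> K \<Longrightarrow> f u \<ge> 1" using f_eventually_ge by blast
  have "u - K \<le> F u" if "u \<ge> K" for u
  proof -
    have "u - K \<le> F u - F K"
      by (rule increment_le[where u = "\<lambda>u. u" and v = F and u' = "\<lambda>_. 1" and v' = f])
        (use K that in \<open>auto intro!: F_deriv continuous_on_subset[OF F_continuous[of u]]\<close>)
    then show ?thesis using F_pos[OF K(1)] by linarith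
  qed
  then have "\<forall>\<^sub>F u in at_top. u - K \<le> F u"
    by (auto simp: eventually_at_top_linorder)
  moreover have "filterlim (\<lambda>u. u - K) at_top at_top"
    by (simp add: filterlim_at_top eventually_at_top_linorder) (metis add.commute le_diff_eq)
  ultimately show ?thesis by (rule filterlim_at_top_mono[rotated])
qed

section \<open>The Osgood integrand and its tail integral \<open>FB\<close>\<close>

abbreviation k :: "real \<Rightarrow> real" where
  "k u \<equiv> 1 / sqrt (F u)"

lemma k_continuous: "continuous_on {0<..} k"
proof -
  have "continuous_on {0<..} F"
    by (rule DERIV_continuous_on[where D = f])
      (auto intro: has_field_derivative_at_within F_deriv)
  then show ?thesis
    by (intro continuous_intros) (use F_pos in force)+
qed

lemma k_integrable_Icc: "a > 0 \<Longrightarrow> k integrable_on {a..b}"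
  by (intro integrable_continuous_real continuous_on_subset[OF k_continuous]) auto

text \<open>Integrability beyond one \<eta> passes to every \<open>a > 0\<close>: either a compact
  piece is cut off or one is added, on which \<open>k\<close> is continuous.\<close>

lemma k_integrable:
  assumes "a > 0"
  shows "k integrable_on {a..}"
proof -
  obtain \<eta> where \<eta>: "\<eta> > 0" "k integrable_on {\<eta>..}" using osgood by blast
  show ?thesis
  proof (cases "\<eta> \<le> a")
    case True
    then show ?thesis using has_integral_tail[OF \<eta>(2)] by blast
  next
    case False
    then have un: "{a..\<eta>} \<union> {\<eta>..} = {a..}" and int: "{a..\<eta>} \<inter> {\<eta>..} = {\<eta>}"
      by auto
    have "(k has_integral integral {a..\<eta>} k + integral {\<eta>..} k) ({a..\<eta>} \<union> {\<eta>..})"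
    proof (rule has_integral_Un)
      show "negligible ({a..\<eta>} \<inter> {\<eta>..})" unfolding int by simp
    qed (use k_integrable_Icc[OF assms] \<eta>(2) in \<open>blast intro: integrable_integral\<close>)+
    then show ?thesis unfolding un by (rule has_integral_integrable)
  qed
qed

lemma FB_split: "0 < a \<Longrightarrow> a \<le> b \<Longrightarrow> FB f a = integral {a..b} k + FB f b"
  unfolding FB_def by (subst integral_unique[OF has_integral_tail[OF k_integrable[of a]]]) auto

text \<open>\<open>k\<close> is decreasing, so it is at least \<open>1 / sqrt (F b)\<close> on
  \<open>{a..b}\<close>. This turns differences of \<open>FB\<close> into upper bounds for doubling
  times.\<close>

lemma FB_diff_ge:
  assumes "0 < a" "a \<le> b"
  shows "(b - a) / sqrt (F b) \<le> FB f a - FB f b"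
proof -
  have "integral {a..b} (\<lambda>_. 1 / sqrt (F b)) \<le> integral {a..b} k"
    using assms F_pos[of a] F_mono
    by (intro integral_le k_integrable_Icc divide_left_mono real_sqrt_le_mono mult_pos_pos) (auto intro: F_pos)
  then show ?thesis using FB_split[OF assms] assms by simp
qed

lemma FB_nonneg: "a > 0 \<Longrightarrow> FB f a \<ge> 0"
  unfolding FB_def
  by (intro integral_nonneg k_integrable) (auto intro!: F_mono[of 0, simplified])

lemma FB_tendsto_0: "(FB f \<longlongrightarrow> 0) at_top"
  unfolding FB_def using integral_tail_tendsto_0 osgood by blast

lemma FB_deriv:
  assumes "u > 0"
  shows "(FB f has_real_derivative - k u) (at u)"
proof -
  \<comment> \<open>Near \<open>u\<close> the tail beyond \<open>u + 1\<close> is a constant; what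
    remains is a compact integral with variable lower limit, hence the minus sign.\<close>
  have "((\<lambda>v. integral {v..u + 1} k) has_real_derivative - k u) (at u within {u / 2..u + 1})"
    using assms by (intro integral_has_real_derivative' continuous_on_subset[OF k_continuous]) auto
  then have "((\<lambda>v. integral {v..u + 1} k + FB f (u + 1)) has_real_derivative - k u) (at u within {u / 2..u + 1})"
    by (auto intro!: derivative_eq_intros)
  then have "((\<lambda>v. integral {v..u + 1} k + FB f (u + 1)) has_real_derivative - k u) (at u)"
    using assms by (simp add: at_within_Icc_at)
  then show ?thesis
    by (rule has_field_derivative_transform_within_open[where S = "{u / 2<..<u + 1}"])
      (use assms in \<open>auto simp: FB_split[symmetric]\<close>)
qed

text \<open>A substitute for the estimate \<open>F A \<le> A * f u\<close> of an increasing
  \<open>f\<close>. Far out, \<open>f\<close> and \<phi> agree up to a factor 2. This is used once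
  to bound \<open>F A\<close> by \<phi> and once to return from \<phi> to \<open>f u\<close>;
  absorbing the initial part \<open>F K1\<close> costs another factor 2.\<close>

lemma asymp_increasing_F_bound:
  assumes "asymp_increasing f"
  shows "\<exists>K>0. \<forall>A\<ge>K. \<forall>u\<ge>A. F A \<le> 8 * A * f u"
proof -
  obtain \<phi> where \<phi>: "\<And>x. x > 0 \<Longrightarrow> \<phi> x > 0" "strict_mono_on {0<..} \<phi>"
      "((\<lambda>x. f x / \<phi> x) \<longlongrightarrow> 1) at_top"
    using assms unfolding asymp_increasing_def by blast
  have \<phi>_mono: "\<phi> a \<le> \<phi> b" if "0 < a" "a \<le> b" for a b
    using strict_mono_on_leD[OF \<phi>(2)] that by simp
  have "\<forall>\<^sub>F x in at_top. f x / \<phi> x \<in> {1/2<..<2}"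
    using order_tendstoD(1)[OF \<phi>(3), of "1/2"] order_tendstoD(2)[OF \<phi>(3), of 2]
    by (auto elim: eventually_elim2)
  then obtain K0 where K0: "\<And>x. x \<ge> K0 \<Longrightarrow> f x / \<phi> x \<in> {1/2<..<2}"
    by (auto simp: eventually_at_top_linorder)
  define K1 where "K1 = max K0 1"
  have K1: "K1 > 0" "f x \<le> 2 * \<phi> x" "\<phi> x \<le> 2 * f x" if "x \<ge> K1" for x
    using K0[of x] \<phi>(1)[of x] that by (auto simp: K1_def field_simps)
  \<comment> \<open>The second term makes \<open>A\<close> large enough to absorb
    \<open>F K1\<close>, the part of the integral where \<phi> does not control
    \<open>f\<close>.\<close>
  define K where "K = max K1 (F K1 / (2 * \<phi> K1))"
  have K: "K \<ge> K1" "K > 0" using K1(1)[of K1] by (auto simp: K_def)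
  have "F A \<le> 8 * A * f u" if A: "A \<ge> K" and u: "u \<ge> A" for A u
  proof -
    have A': "A \<ge> K1" "K1 > 0" using A K K1(1)[of K1] by auto
    have "F A - F K1 \<le> 2 * \<phi> A * A - 2 * \<phi> A * K1"
    proof (rule increment_le[where u = F and u' = f and v' = "\<lambda>_. 2 * \<phi> A"])
      fix t assume t: "K1 < t" "t < A"
      show "f t \<le> 2 * \<phi> A" using K1(2)[of t] \<phi>_mono[of t A] t A' by auto
    qed (use A' in \<open>auto intro!: F_deriv derivative_eq_intros continuous_intros continuous_on_subset[OF F_continuous[of A]]\<close>)
    moreover have "F K1 \<le> 2 * \<phi> A * A"
    proof -
      have "F K1 / (2 * \<phi> K1) \<le> A" using A by (simp add: K_def)
      then have "F K1 \<le> 2 * \<phi> K1 * A" using \<phi>(1)[of K1] A' by (simp add: field_simps)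
      also have "\<dots> \<le> 2 * \<phi> A * A" using \<phi>_mono[of K1 A] A' by (intro mult_right_mono) auto
      finally show ?thesis .
    qed
    moreover have "2 * \<phi> A * K1 \<ge> 0" using \<phi>(1)[of A] A' by simp
    ultimately have "F A \<le> 4 * (A * \<phi> A)" by (simp add: algebra_simps)
    also have "A * \<phi> A \<le> A * (2 * f u)"
      using K1(3)[of u] \<phi>_mono[of A u] A' u by (intro mult_left_mono) auto
    finally show ?thesis by simp
  qed
  then show ?thesis using K(2) by blast
qed

end

section \<open>Solutions of the equation\<close>

locale volterra = osgood +
  fixes w h :: "real \<Rightarrow> real" and \<psi> :: real
  assumes w_cont: "continuous_on {0..} w"
    and w_nonneg: "t \<ge> 0 \<Longrightarrow> w t \<ge> 0"
    and w0: "w 0 > 0"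
    and h_cont: "continuous_on UNIV h"
    and H_nonneg: "t \<ge> 0 \<Longrightarrow> integral {0..t} h \<ge> 0"
    and psi_pos: "\<psi> > 0"
begin

section \<open>Solutions on compact intervals and their positivity\<close>

abbreviation H :: "real \<Rightarrow> real" where
  "H t \<equiv> integral {0..t} h"

text \<open>Two-sided derivatives at interior points only, so that every restriction of a solution
  to \<open>{0..b}\<close> inside its domain qualifies. For \<open>b = 0\<close> only the initial
  value remains.\<close>

definition solves :: "(real \<Rightarrow> real) \<Rightarrow> real \<Rightarrow> bool" where
  "solves x b \<longleftrightarrow> x 0 = \<psi> \<and> continuous_on {0..b} x \<and>
     (\<forall>t\<in>{0<..<b}. (x has_real_derivative (h t + conv w (\<lambda>s. f (x s)) t)) (at t))"

lemma solvesD: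
  assumes "solves x b"
  shows "x 0 = \<psi>" "continuous_on {0..b} x"
    "0 < t \<Longrightarrow> t < b \<Longrightarrow> (x has_real_derivative (h t + conv w (\<lambda>s. f (x s)) t)) (at t)"
  using assms by (auto simp: solves_def)

lemma h_integrable: "h integrable_on {a..b}"
  by (intro integrable_continuous_real continuous_on_subset[OF h_cont]) simp

lemma H_continuous: "continuous_on {0..b} H"
  by (intro indefinite_integral_continuous_1 h_integrable)

lemma H_deriv: "t > 0 \<Longrightarrow> (H has_real_derivative h t) (at t)"
  by (rule integral_atLeastAtMost_has_real_derivative[of h "t + 1"])
    (auto intro: h_integrable continuous_on_subset[OF h_cont])

text \<open>The integrand is nonnegative, so the history before \<open>a\<close> may be
  discarded.\<close>

lemma conv_ge_tail:
  assumes "0 \<le> a" "a \<le> t" "continuous_on {0..t} q" "\<And>s. s \<in> {0..t} \<Longrightarrow> q s \<ge> 0"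
  shows "integral {a..t} (\<lambda>s. w (t - s) * q s) \<le> conv w q t"
  unfolding conv_def
proof (rule integral_subset_le)
  show "(\<lambda>s. w (t - s) * q s) integrable_on {a..t}" "(\<lambda>s. w (t - s) * q s) integrable_on {0..t}"
    using assms by (auto intro!: integrable_continuous_real conv_integrand_continuous[OF w_cont]
        intro: continuous_on_subset[OF assms(3)])
  show "\<forall>s\<in>{0..t}. 0 \<le> w (t - s) * q s"
    using assms(4) by (intro ballI mult_nonneg_nonneg w_nonneg) auto
qed (use assms(1) in auto)

lemma conv_nonneg:
  assumes "continuous_on {0..t} q" "\<And>s. s \<in> {0..t} \<Longrightarrow> q s \<ge> 0"
  shows "conv w q t \<ge> 0"
proof (cases "t \<ge> 0")
  case True
  then show ?thesis using conv_ge_tail[of t t q] assms by simp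
next
  case False
  then show ?thesis by (simp add: conv_def)
qed

lemma f_comp_continuous:
  assumes "continuous_on S x" "\<And>t. t \<in> S \<Longrightarrow> x t > 0"
  shows "continuous_on S (\<lambda>t. f (x t))"
  by (rule continuous_on_compose2[OF f_cont assms(1)]) (use assms(2) in auto)

lemma solution_ge_psi:
  assumes sol: "solves x b" and t: "t \<in> {0..b}"
  shows "\<psi> \<le> x t"
proof (rule ccontr)
  assume "\<not> \<psi> \<le> x t"
  \<comment> \<open>A level strictly between \<open>max (x t) 0\<close> and \<psi>. It is positive,
    so \<open>f (x s) > 0\<close> as long as \<open>x s > l\<close>.\<close>
  define l where "l = (max (x t) 0 + \<psi>) / 2"
  have l: "0 < l" "x t < l" "l < \<psi>"
    using \<open>\<not> \<psi> \<le> x t\<close> psi_pos by (auto simp: l_def)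
  \<comment> \<open>At the first time \<open>t0\<close> where \<open>x\<close> drops to the level \<open>l\<close>, the equation still forces \<open>x t0 \<ge> \<psi> + H t0\<close>.\<close>
  define S where "S = {s \<in> {0..t}. x s \<le> l}"
  define t0 where "t0 = Inf S"
  have cont: "continuous_on {0..t} x"
    using t by (intro continuous_on_subset[OF solvesD(2)[OF sol]]) auto
  have "closed S" unfolding S_def
    by (intro continuous_on_closed_Collect_le continuous_intros cont)
  moreover have "S \<noteq> {}" "bdd_below S" using t l by (auto simp: S_def intro!: bdd_belowI[of _ 0])
  ultimately have t0: "t0 \<in> S" and min: "\<And>s. s \<in> S \<Longrightarrow> t0 \<le> s"
    unfolding t0_def by (auto intro: closed_contains_Inf cInf_lower)
  have gt: "x s > l" if "s \<in> {0..<t0}" for s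
    using min[of s] t0 that by (force simp: S_def)
  have "H t0 - H 0 \<le> x t0 - x 0"
  proof (rule increment_le[where u' = h])
    fix s assume s: "0 < s" "s < t0"
    show "(x has_real_derivative (h s + conv w (\<lambda>s. f (x s)) s)) (at s)"
      using s t0 t by (intro solvesD(3)[OF sol]) (auto simp: S_def)
    have "continuous_on {0..s} (\<lambda>s. f (x s))"
      using s t0 gt l by (intro f_comp_continuous continuous_on_subset[OF cont]) (force simp: S_def)+
    moreover have "f (x r) \<ge> 0" if "r \<in> {0..s}" for r
      using gt[of r] f_pos[of "x r"] that s l by auto
    ultimately show "h s \<le> h s + conv w (\<lambda>s. f (x s)) s"
      using conv_nonneg[of s "\<lambda>s. f (x s)"] by simp
  qed (use t0 in \<open>auto simp: S_def intro!: H_deriv H_continuous continuous_on_subset[OF cont]\<close>)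
  then have "x t0 \<ge> \<psi>" using H_nonneg[of t0] t0 solvesD(1)[OF sol] by (auto simp: S_def)
  then show False using t0 l by (auto simp: S_def)
qed

lemma solution_pos: "solves x b \<Longrightarrow> t \<in> {0..b} \<Longrightarrow> x t > 0"
  using solution_ge_psi psi_pos by fastforce

lemma f_solution_continuous: "solves x b \<Longrightarrow> continuous_on {0..b} (\<lambda>t. f (x t))"
  by (intro f_comp_continuous solvesD(2) solution_pos) auto

lemma f_solution_pos: "solves x b \<Longrightarrow> t \<in> {0..b} \<Longrightarrow> f (x t) > 0"
  by (intro f_pos solution_pos)

section \<open>Monotonicity and growth of \<open>x - H\<close>\<close>

lemma solution_minus_H_deriv:
  assumes "solves x b" "0 < t" "t < b"
  shows "((\<lambda>t. x t - H t) has_real_derivative conv w (\<lambda>s. f (x s)) t) (at t)"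
  using solvesD(3)[OF assms] H_deriv[OF assms(2)] by (auto intro!: derivative_eq_intros)

lemma solution_minus_H_continuous:
  "solves x b \<Longrightarrow> continuous_on {0..b} (\<lambda>t. x t - H t)"
  by (intro continuous_intros solvesD(2) H_continuous)

text \<open>Keeping only the memory since time \<open>s\<close> bounds the derivative of
  \<open>x - H\<close> at \<open>r\<close> below by \<open>c * \<mu> * (r - s)\<close>, and
  integration gives the quadratic term.\<close>

lemma solution_growth:
  assumes sol: "solves x b" and st: "0 \<le> s" "s \<le> t" "t \<le> b"
    and c: "\<And>r. r \<in> {0..t - s} \<Longrightarrow> w r \<ge> c" "c \<ge> 0"
    and \<mu>: "\<And>r. r \<in> {s..t} \<Longrightarrow> f (x r) \<ge> \<mu>" "\<mu> \<ge> 0"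
  shows "c * \<mu> * (t - s)\<^sup>2 / 2 \<le> (x t - H t) - (x s - H s)"
proof -
  have "(\<lambda>r. c * \<mu> * (r - s)\<^sup>2 / 2) t - (\<lambda>r. c * \<mu> * (r - s)\<^sup>2 / 2) s \<le> (x t - H t) - (x s - H s)"
  proof (rule increment_le[OF st(2)])
    fix r assume r: "s < r" "r < t"
    show "((\<lambda>r. c * \<mu> * (r - s)\<^sup>2 / 2) has_real_derivative c * \<mu> * (r - s)) (at r)"
      by (auto intro!: derivative_eq_intros)
    show "((\<lambda>t. x t - H t) has_real_derivative conv w (\<lambda>s. f (x s)) r) (at r)"
      using r st by (intro solution_minus_H_deriv[OF sol]) auto
    have fc: "continuous_on {0..r} (\<lambda>s. f (x s))"
      using r st by (intro continuous_on_subset[OF f_solution_continuous[OF sol]]) auto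
    have "c * \<mu> * (r - s) = integral {s..r} (\<lambda>_. c * \<mu>)" using r by simp
    also have "\<dots> \<le> integral {s..r} (\<lambda>q. w (r - q) * f (x q))"
    proof (rule integral_le)
      show "(\<lambda>q. w (r - q) * f (x q)) integrable_on {s..r}"
        using r st by (intro integrable_continuous_real conv_integrand_continuous[OF w_cont]
            continuous_on_subset[OF fc]) auto
      show "c * \<mu> \<le> w (r - q) * f (x q)" if "q \<in> {s..r}" for q
        using that r st c \<mu> by (intro mult_mono w_nonneg) auto
    qed auto
    also have "\<dots> \<le> conv w (\<lambda>s. f (x s)) r"
      using r st by (intro conv_ge_tail fc) (auto intro!: less_imp_le[OF f_solution_pos[OF sol]])
    finally show "c * \<mu> * (r - s) \<le> conv w (\<lambda>s. f (x s)) r" .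
  qed (use st in \<open>auto intro!: continuous_intros continuous_on_subset[OF solution_minus_H_continuous[OF sol]]\<close>)
  then show ?thesis by simp
qed

lemma solution_minus_H_mono:
  assumes sol: "solves x b" and "0 \<le> s" "s \<le> t" "t \<le> b"
  shows "x s - H s \<le> x t - H t"
  \<comment> \<open>The growth estimate with \<open>c = 0\<close> and
    \<open>\<mu> = 0\<close>.\<close>
  using solution_growth[OF sol, of s t 0 0] assms w_nonneg
  by (force intro: less_imp_le[OF f_solution_pos[OF sol]])

lemma w_lower_bound: "\<exists>c>0. \<exists>\<delta>>0. \<forall>s\<in>{0..\<delta>}. w s \<ge> c"
proof -
  have "(w \<longlongrightarrow> w 0) (at 0 within {0..})"
    using w_cont by (auto simp: continuous_on_def)
  then have "\<forall>\<^sub>F s in at 0 within {0..}. w s > w 0 / 2"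
    using w0 by (intro order_tendstoD) auto
  then obtain d where d: "d > 0" "\<And>s. s \<in> {0..} \<Longrightarrow> s \<noteq> 0 \<Longrightarrow> dist s 0 < d \<Longrightarrow> w s > w 0 / 2"
    by (auto simp: eventually_at)
  have "w s \<ge> w 0 / 2" if "s \<in> {0..d/2}" for s
    using d(2)[of s] d(1) that w0 by (cases "s = 0") (auto simp: dist_real_def intro: less_imp_le)
  then show ?thesis using w0 d(1) by (intro exI[of _ "w 0 / 2"] conjI exI[of _ "d / 2"]) auto
qed

subsection \<open>No global solutions\<close>

text \<open>As \<open>x\<close> stays above \<psi>, \<open>f (x t)\<close> is at least a fixed
  \<open>m > 0\<close>. Each time span \<delta> then raises \<open>x - H\<close> by at least the
  fixed amount \<open>e\<close>.\<close>

lemma global_solution_unbounded: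
  assumes sol: "\<And>b. b \<ge> 0 \<Longrightarrow> solves x b"
  shows "\<exists>t\<ge>0. x t - H t \<ge> A"
proof -
  obtain c \<delta> where c: "c > 0" "\<delta> > 0" "\<And>s. s \<in> {0..\<delta>} \<Longrightarrow> w s \<ge> c"
    using w_lower_bound by blast
  obtain m where m: "m > 0" "\<And>u. u \<ge> \<psi> \<Longrightarrow> f u \<ge> m" using f_lower_bound[OF psi_pos] by blast
  define e where "e = c * m * \<delta>\<^sup>2 / 2"
  have "e > 0" using c m by (simp add: e_def)
  have grow: "real n * e \<le> x (real n * \<delta>) - H (real n * \<delta>)" for n
  proof (induction n)
    case 0
    then show ?case using solvesD(1)[OF sol[of 0]] psi_pos by simp
  next
    case (Suc n)
    have eq: "real (Suc n) * \<delta> - real n * \<delta> = \<delta>" by (simp add: algebra_simps)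
    have "c * m * (real (Suc n) * \<delta> - real n * \<delta>)\<^sup>2 / 2
        \<le> (x (real (Suc n) * \<delta>) - H (real (Suc n) * \<delta>)) - (x (real n * \<delta>) - H (real n * \<delta>))"
    proof (rule solution_growth)
      show "solves x (real (Suc n) * \<delta>)" using c by (intro sol) auto
      then show "m \<le> f (x r)" if "r \<in> {real n * \<delta>..real (Suc n) * \<delta>}" for r
        using that c(2) by (intro m(2) solution_ge_psi[of x "real (Suc n) * \<delta>"]) (auto intro: order_trans[rotated])
      show "c \<le> w r" if "r \<in> {0..real (Suc n) * \<delta> - real n * \<delta>}" for r
        using that unfolding eq by (rule c(3))
    qed (use c m in auto)
    then have "e \<le> (x (real (Suc n) * \<delta>) - H (real (Suc n) * \<delta>)) - (x (real n * \<delta>) - H (real n * \<delta>))"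
      unfolding eq e_def .
    then show ?case using Suc.IH by (simp add: algebra_simps)
  qed
  obtain n where "A / e \<le> real n" using real_arch_simple by blast
  then have "A \<le> real n * e" using \<open>e > 0\<close> by (simp add: field_simps)
  then show ?thesis using grow[of n] c(2) by (intro exI[of _ "real n * \<delta>"]) auto
qed

text \<open>Each doubling of \<open>y = x - H\<close> from the level \<open>A\<close> takes at most a constant multiple of
  \<open>FB f (A / 2) - FB f A\<close>; these times telescope to a finite total.\<close>
lemma no_global_solution:
  assumes sol: "\<And>b. b \<ge> 0 \<Longrightarrow> solves x b" and asymp: "asymp_increasing f"
  shows False
proof -
  define y where "y t = x t - H t" for t
  have y_mono: "y s \<le> y t" if "0 \<le> s" "s \<le> t" for s t
    unfolding y_def using solution_minus_H_mono[OF sol[of t]] that by simp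
  obtain c \<delta> where c: "c > 0" "\<delta> > 0" "\<And>s. s \<in> {0..\<delta>} \<Longrightarrow> w s \<ge> c"
    using w_lower_bound by blast
  obtain K where K: "K > 0" "\<And>A u. A \<ge> K \<Longrightarrow> u \<ge> A \<Longrightarrow> F A \<le> 8 * A * f u"
    using asymp_increasing_F_bound[OF asymp] by blast
  \<comment> \<open>Chosen so that the growth estimate over a time
    \<open>\<kappa> * (A / 2) / sqrt (F A)\<close>, with \<open>f\<close> at least
    \<open>F A / (8 * A)\<close>, yields exactly the gain \<open>A\<close>.\<close>
  define \<kappa> where "\<kappa> = 8 / sqrt c"
  have \<kappa>: "\<kappa> > 0" "\<kappa>\<^sup>2 = 64 / c"
    using c by (auto simp: \<kappa>_def power_divide)
  \<comment> \<open>Makes every doubling time at most \<delta>, the range on which \<open>w\<close>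
    is at least \<open>c\<close>.\<close>
  have "\<forall>\<^sub>F u in at_top. FB f u < \<delta> / \<kappa>"
    using c \<kappa> by (intro order_tendstoD[OF FB_tendsto_0]) auto
  then obtain K' where K': "\<And>u. u \<ge> K' \<Longrightarrow> FB f u < \<delta> / \<kappa>"
    by (auto simp: eventually_at_top_linorder)
  define A0 where "A0 = max K (2 * K')"
  have A0: "A0 > 0" "A0 \<ge> K" "A0 / 2 \<ge> K'" using K(1) by (auto simp: A0_def)
  define A where "A n = 2 ^ n * A0" for n
  have A_ge: "A n \<ge> A0" for n
    using A0 by (simp add: A_def)
  have A_pos: "A n > 0" for n using A_ge[of n] A0 by linarith
  have A_Suc: "A (Suc n) = 2 * A n" for n by (simp add: A_def)
  obtain t0 where t0: "t0 \<ge> 0" "y t0 \<ge> A0"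
    using global_solution_unbounded[OF sol] unfolding y_def by blast
  \<comment> \<open>The sum of the times \<open>\<kappa> * (FB f (A j / 2) - FB f (A j))\<close> for
    \<open>j < n\<close>, telescoped by \<open>A (j + 1) / 2 = A j\<close>.\<close>
  define T where "T n = t0 + \<kappa> * (FB f (A0 / 2) - FB f (A n / 2))" for n
  have FB_A0: "FB f u \<le> FB f (A0 / 2)" if "u \<ge> A0 / 2" for u
    using FB_diff_ge[of "A0 / 2" u] that A0 F_pos[of u]
    by (smt (verit) divide_nonneg_nonneg half_gt_zero real_sqrt_ge_zero)
  have T_ge: "T n \<ge> t0" for n
    using FB_A0[of "A n / 2"] A_ge[of n] \<kappa> by (simp add: T_def)
  have "y (T n) \<ge> A n" for n
  proof (induction n)
    case 0
    then show ?case using t0 by (simp add: T_def A_def)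
  next
    case (Suc n)
    define s where "s = T (Suc n) - T n"
    have s_eq: "s = \<kappa> * (FB f (A n / 2) - FB f (A n))"
      by (simp add: s_def T_def A_Suc algebra_simps)
    have "\<kappa> * ((A n - A n / 2) / sqrt (F (A n))) \<le> s"
      unfolding s_eq using \<kappa> A_pos[of n] by (intro mult_left_mono FB_diff_ge) auto
    then have s_ge: "\<kappa> * (A n / 2) / sqrt (F (A n)) \<le> s" by simp
    have FA: "F (A n) > 0" by (rule F_pos[OF A_pos])
    then have s_nonneg: "0 \<le> s"
      using s_ge \<kappa> A_pos[of n] by (intro order_trans[OF _ s_ge]) simp
    have "FB f (A n / 2) \<le> FB f (A0 / 2)" "FB f (A n) \<ge> 0" "FB f (A0 / 2) < \<delta> / \<kappa>"
      using FB_A0[of "A n / 2"] A_ge[of n] FB_nonneg[OF A_pos[of n]] K' A0 by auto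
    then have "s \<le> \<kappa> * (\<delta> / \<kappa>)" unfolding s_eq using \<kappa> by (intro mult_left_mono) auto
    then have s_le: "s \<le> \<delta>" using \<kappa> by simp
    have "64 / c * (A n)\<^sup>2 / (4 * F (A n)) = (\<kappa> * (A n / 2) / sqrt (F (A n)))\<^sup>2"
      using FA \<kappa>(2) by (simp add: power_divide power_mult_distrib)
    also have "\<dots> \<le> s\<^sup>2"
      using s_ge \<kappa> A_pos[of n] FA by (intro power_mono) auto
    finally have s2: "64 / c * (A n)\<^sup>2 / (4 * F (A n)) \<le> s\<^sup>2" .
    have "c * (F (A n) / (8 * A n)) * (T (Suc n) - T n)\<^sup>2 / 2 \<le> y (T (Suc n)) - y (T n)"
      unfolding y_def
    proof (rule solution_growth[OF sol])
      show "0 \<le> T (Suc n)" "0 \<le> T n" using T_ge t0 by (auto intro: order_trans)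
      show "T n \<le> T (Suc n)" using s_nonneg by (simp add: s_def)
      show "c \<le> w r" if "r \<in> {0..T (Suc n) - T n}" for r
        using that s_le by (intro c(3)) (auto simp: s_def)
      \<comment> \<open>From time \<open>T n\<close> on, \<open>x\<close> is at least
        \<open>y\<close>, which is at least \<open>A n\<close> by induction and
        monotonicity.\<close>
      show "F (A n) / (8 * A n) \<le> f (x r)" if r: "r \<in> {T n..T (Suc n)}" for r
      proof -
        have "r \<ge> 0" using r T_ge[of n] t0 by auto
        then have "A n \<le> y r" using Suc.IH y_mono[of "T n" r] r T_ge[of n] t0 by auto
        then have "A n \<le> x r" using H_nonneg[OF \<open>r \<ge> 0\<close>] by (simp add: y_def)
        then have "F (A n) \<le> 8 * A n * f (x r)" using A_ge[of n] A0 by (intro K(2)) auto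
        then show ?thesis using A_pos[of n] by (simp add: field_simps)
      qed
    qed (use c FA A_pos[of n] in auto)
    moreover have "A n \<le> c * (F (A n) / (8 * A n)) * (T (Suc n) - T n)\<^sup>2 / 2"
    proof -
      have "A n = c * (F (A n) / (8 * A n)) * (64 / c * (A n)\<^sup>2 / (4 * F (A n))) / 2"
        using c FA A_pos[of n] by (simp add: field_simps power2_eq_square)
      also have "\<dots> \<le> c * (F (A n) / (8 * A n)) * s\<^sup>2 / 2"
        using s2 c FA A_pos[of n] by (intro divide_right_mono mult_left_mono) auto
      finally show ?thesis by (simp add: s_def)
    qed
    ultimately show ?case using Suc.IH by (simp add: A_Suc)
  qed
  \<comment> \<open>All \<open>T n\<close> lie before one fixed time, so \<open>y\<close> there
    would exceed every \<open>A n\<close>.\<close>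
  moreover have "y (T n) \<le> y (t0 + \<kappa> * FB f (A0 / 2))" for n
    using T_ge[of n] t0 \<kappa> FB_nonneg[of "A n / 2"] A_pos[of n]
    by (intro y_mono) (auto simp: T_def)
  ultimately have "2 ^ n \<le> y (t0 + \<kappa> * FB f (A0 / 2)) / A0" for n
    using A0 order_trans unfolding A_def by (simp add: field_simps) blast
  moreover obtain n where "2 ^ n > y (t0 + \<kappa> * FB f (A0 / 2)) / A0"
    using real_arch_pow[of 2] by auto
  ultimately show False by (meson not_less)
qed

subsection \<open>The rate of blow-up\<close>

lemma blow_up_rate:
  assumes sol: "\<And>b. 0 \<le> b \<Longrightarrow> b < T \<Longrightarrow> solves x b" and "T > 0"
    and blow: "filterlim x at_top (at_left T)"
  shows "((\<lambda>t. FB f (x t) / (T - t)) \<longlongrightarrow> sqrt (2 * w 0)) (at_left T)"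
proof -
  define q where "q t = f (x t)" for t
  define I where "I t = integral {0..t} q" for t
  define x' where "x' t = h t + conv w q t" for t
  have ev: "\<forall>\<^sub>F t in at_left T. a < t \<and> t < T" if "a < T" for a
    using that by (auto simp: eventually_at_left_field)
  have q_cont: "continuous_on {a..b} q" if "0 \<le> a" "b < T" for a b
  proof (cases "a \<le> b")
    case True
    then show ?thesis
      using f_solution_continuous[OF sol[of b]] that unfolding q_def
      by (auto elim: continuous_on_subset)
  qed auto
  have q_int: "q integrable_on {a..b}" if "0 \<le> a" "b < T" for a b
    by (rule integrable_continuous_real[OF q_cont[OF that]])
  have cq_int: "(\<lambda>s. c * q s) integrable_on {a..b}" if "0 \<le> a" "b < T" for a b c
    by (intro integrable_continuous_real continuous_intros q_cont that)
  have q_pos: "q t > 0" if "0 \<le> t" "t < T" for t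
    using f_solution_pos[OF sol[of t]] that by (simp add: q_def)
  have x_pos: "x t > 0" if "0 \<le> t" "t < T" for t
    using solution_pos[OF sol[of t]] that by simp
  \<comment> \<open>The midpoint of \<open>t\<close> and \<open>T\<close> bounds a compact interval
    that has \<open>t\<close> inside and lies before \<open>T\<close>.\<close>
  have mid: "(t + T) / 2 < T" "t < (t + T) / 2" if "t < T" for t
    using that by auto
  have x_deriv: "(x has_real_derivative x' t) (at t)" if "0 < t" "t < T" for t
    using solvesD(3)[OF sol[of "(t + T) / 2"], of t] mid[of t] that \<open>T > 0\<close>
    unfolding x'_def q_def by auto
  have I_deriv: "(I has_real_derivative q t) (at t)" if "0 < t" "t < T" for t
    unfolding I_def
    by (rule integral_atLeastAtMost_has_real_derivative[of q "(t + T) / 2"])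
      (use that mid[of t] in \<open>auto intro!: q_int intro: continuous_on_subset[OF q_cont[of 0 "(t + T) / 2"]]\<close>)
  have I_cont: "continuous_on {0..t} I" if "t < T" for t
    unfolding I_def by (intro indefinite_integral_continuous_1 q_int) (use that in auto)
  have I_split: "I t = I a + integral {a..t} q" if "0 \<le> a" "a \<le> t" "t < T" for a t
    unfolding I_def using that
    by (intro Henstock_Kurzweil_Integration.integral_combine[symmetric] q_int) auto
  have tail_nonneg: "integral {a..t} q \<ge> 0" if "0 \<le> a" "t < T" for a t
    using that by (intro integral_nonneg q_int) (auto intro!: less_imp_le[OF q_pos])
  have I_mono: "I a \<le> I t" if "0 \<le> a" "a \<le> t" "t < T" for a t
    using I_split[OF that] tail_nonneg[of a t] that by simp
  have I_nonneg: "I t \<ge> 0" if "0 \<le> t" "t < T" for t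
    unfolding I_def using that by (intro tail_nonneg) auto
  have "compact (w ` {0..T})" "compact (h ` {0..T})"
    by (auto intro!: compact_continuous_image continuous_on_subset[OF w_cont] continuous_on_subset[OF h_cont])
  then obtain W M where W: "W > 0" "\<And>s. s \<in> {0..T} \<Longrightarrow> \<bar>w s\<bar> \<le> W"
    and M: "M > 0" "\<And>s. s \<in> {0..T} \<Longrightarrow> \<bar>h s\<bar> \<le> M"
    by (metis compact_imp_bounded bounded_pos image_eqI real_norm_def)
  have wq_int: "(\<lambda>s. w (t - s) * q s) integrable_on {a..b}" if "0 \<le> a" "b \<le> t" "t < T" for a b t
    using that by (intro integrable_continuous_real conv_integrand_continuous[OF w_cont] q_cont) auto
  have conv_le: "conv w q t \<le> W * I t" if "0 \<le> t" "t < T" for t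
  proof -
    have "conv w q t \<le> integral {0..t} (\<lambda>s. W * q s)"
      unfolding conv_def
    proof (rule integral_le)
      show "w (t - s) * q s \<le> W * q s" if "s \<in> {0..t}" for s
        using that \<open>t < T\<close> W(2)[of "t - s"] less_imp_le[OF q_pos[of s]] by (intro mult_right_mono) auto
    qed (use that in \<open>auto intro!: wq_int cq_int\<close>)
    then show ?thesis by (simp add: I_def)
  qed

  \<comment> \<open>If \<open>I\<close> stayed below \<open>Z\<close>, then \<open>x'\<close> would
    be at most \<open>M + W * Z\<close>, and \<open>x\<close> would remain bounded on the finite
    interval. Since \<open>I\<close> is nondecreasing, unboundedness gives divergence.\<close>
  have I_top: "filterlim I at_top (at_left T)"
  proof -
    have "\<exists>t. 0 \<le> t \<and> t < T \<and> I t \<ge> Z" for Z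
    proof (rule ccontr)
      assume "\<not> ?thesis"
      then have Z: "I t \<le> Z" if "0 \<le> t" "t < T" for t using that by force
      have "x t \<le> \<psi> + (M + W * Z) * T" if t: "0 < t" "t < T" for t
      proof -
        have "x t - x 0 \<le> (M + W * Z) * t - (M + W * Z) * 0"
        proof (rule increment_le[where u' = x' and v' = "\<lambda>_. M + W * Z"])
          fix s assume s: "0 < s" "s < t"
          then have "conv w q s \<le> W * I s" using t by (intro conv_le) auto
          also have "\<dots> \<le> W * Z" using Z[of s] W s t by (intro mult_left_mono) auto
          finally show "x' s \<le> M + W * Z" using M(2)[of s] s t by (simp add: x'_def)
          show "(x has_real_derivative x' s) (at s)" using s t by (intro x_deriv) auto
        qed (use t solvesD(2)[OF sol[of t]] in \<open>auto intro!: continuous_intros derivative_eq_intros\<close>)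
        also have "\<dots> \<le> (M + W * Z) * T"
          using t M(1) W(1) Z[of 0] I_nonneg[of 0] \<open>T > 0\<close> by (simp add: mult_left_mono)
        finally show ?thesis using solvesD(1)[OF sol[of 0]] \<open>T > 0\<close> by simp
      qed
      moreover have "\<forall>\<^sub>F t in at_left T. x t > \<psi> + (M + W * Z) * T"
        using blow by (simp add: filterlim_at_top_dense)
      ultimately show False
        using eventually_happens[OF eventually_conj[OF _ ev[OF \<open>T > 0\<close>]]] trivial_limit_at_left_real
        by (metis linorder_not_less)
    qed
    then have "\<forall>\<^sub>F t in at_left T. Z \<le> I t" for Z
    proof -
      obtain a where a: "0 \<le> a" "a < T" "I a \<ge> Z" using \<open>\<exists>t. 0 \<le> t \<and> t < T \<and> I t \<ge> Z\<close> by blast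
      show ?thesis using ev[OF a(2)]
      proof eventually_elim
        case (elim t)
        then show ?case using I_mono[OF a(1), of t] a(3) by auto
      qed
    qed
    then show ?thesis by (simp add: filterlim_at_top)
  qed
  then have I_large: "\<forall>\<^sub>F t in at_left T. I t > Z" for Z
    by (simp add: filterlim_at_top_dense)

  \<comment> \<open>Since \<open>T\<close> is finite and \<open>I\<close> diverges, only the values of \<open>w\<close> near \<open>0\<close> matter in the limit.\<close>
  have ratio: "((\<lambda>t. x' t / I t) \<longlongrightarrow> w 0) (at_left T)"
  proof (rule tendstoI)
    fix e :: real assume "e > 0"
    have "\<exists>d>0. \<forall>s\<in>{0..}. dist s 0 < d \<longrightarrow> dist (w s) (w 0) < e / 3"
      using w_cont \<open>e > 0\<close> unfolding continuous_on_iff by (metis atLeast_iff divide_pos_pos order_refl zero_less_numeral)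
    then obtain d where d: "d > 0" "\<And>s. 0 \<le> s \<Longrightarrow> s < d \<Longrightarrow> \<bar>w s - w 0\<bar> < e / 3"
      by (auto simp: dist_real_def)
    \<comment> \<open>For \<open>s\<close> between \<open>a\<close> and \<open>t < T\<close> the lag
      \<open>t - s\<close> is below \<open>d\<close>, so \<open>w (t - s)\<close> is close to
      \<open>w 0\<close>.\<close>
    define a where "a = max 0 (T - d / 2)"
    have a: "0 \<le> a" "a < T" "T - a < d" using d(1) \<open>T > 0\<close> by (auto simp: a_def)
    \<comment> \<open>Contributions bounded independently of \<open>t\<close>: the forcing
      \<open>h\<close>, and the memory before \<open>a\<close>, where \<open>w (t - s)\<close>
      differs from \<open>w 0\<close> by at most \<open>2 * W\<close>.\<close>
    define C where "C = M + 2 * W * I a"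
    have close: "\<bar>x' t - w 0 * I t\<bar> \<le> e / 3 * I t + C" if t: "a < t" "t < T" for t
    proof -
      have int: "(\<lambda>s. (w (t - s) - w 0) * q s) integrable_on {b..c}" if "0 \<le> b" "c \<le> t" for b c
        using that t by (simp only: left_diff_distrib) (intro integrable_diff wq_int cq_int, auto)
      have "conv w q t - w 0 * I t = integral {0..t} (\<lambda>s. (w (t - s) - w 0) * q s)"
        using t a unfolding conv_def I_def left_diff_distrib
        by (subst integral_diff) (auto intro!: wq_int cq_int)
      also have "\<dots> = integral {0..a} (\<lambda>s. (w (t - s) - w 0) * q s) + integral {a..t} (\<lambda>s. (w (t - s) - w 0) * q s)"
        using a t by (intro Henstock_Kurzweil_Integration.integral_combine[symmetric] int) auto
      finally have eq: "conv w q t - w 0 * I t = \<dots>" .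
      have "norm (integral {0..a} (\<lambda>s. (w (t - s) - w 0) * q s)) \<le> integral {0..a} (\<lambda>s. 2 * W * q s)"
      proof (rule integral_norm_bound_integral)
        fix s assume s: "s \<in> {0..a}"
        have "\<bar>w (t - s) - w 0\<bar> \<le> 2 * W"
          using W(2)[of "t - s"] W(2)[of 0] s t a by auto
        then show "norm ((w (t - s) - w 0) * q s) \<le> 2 * W * q s"
          using q_pos[of s] s a by (simp add: abs_mult)
      qed (use a t in \<open>auto intro!: int cq_int\<close>)
      then have 1: "\<bar>integral {0..a} (\<lambda>s. (w (t - s) - w 0) * q s)\<bar> \<le> 2 * W * I a"
        by (simp add: I_def)
      have "norm (integral {a..t} (\<lambda>s. (w (t - s) - w 0) * q s)) \<le> integral {a..t} (\<lambda>s. e / 3 * q s)"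
      proof (rule integral_norm_bound_integral)
        fix s assume s: "s \<in> {a..t}"
        have "\<bar>w (t - s) - w 0\<bar> \<le> e / 3"
          using d(2)[of "t - s"] s t a by auto
        then have "\<bar>w (t - s) - w 0\<bar> * q s \<le> e / 3 * q s"
          using q_pos[of s] s a t by (intro mult_right_mono) auto
        then show "norm ((w (t - s) - w 0) * q s) \<le> e / 3 * q s"
          using q_pos[of s] s a t by (simp add: abs_mult)
      qed (use a t in \<open>auto intro!: int cq_int\<close>)
      then have "\<bar>integral {a..t} (\<lambda>s. (w (t - s) - w 0) * q s)\<bar> \<le> e / 3 * integral {a..t} q"
        by simp
      also have "\<dots> \<le> e / 3 * I t"
        using I_split[of a t] I_nonneg[of a] a t \<open>e > 0\<close> by (intro mult_left_mono) auto
      finally show ?thesis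
        using 1 eq M(2)[of t] a t unfolding x'_def C_def by auto
    qed
    have C: "C \<ge> 0" using M W I_nonneg[of a] a by (simp add: C_def)
    \<comment> \<open>Once \<open>I t > 3 * C / e\<close>, the constant \<open>C\<close> adds less
      than another third of \<open>e * I t\<close>.\<close>
    show "\<forall>\<^sub>F t in at_left T. dist (x' t / I t) (w 0) < e"
      using ev[OF a(2)] I_large[of "3 * C / e"] I_large[of 0]
    proof eventually_elim
      case (elim t)
      have I: "I t > 0" "C < e / 3 * I t"
        using elim \<open>e > 0\<close> by (auto simp: field_simps)
      have "\<bar>x' t - w 0 * I t\<bar> < e * I t"
        using close[of t] elim I mult_pos_pos[OF \<open>e > 0\<close> I(1)] by simp
      moreover have "x' t / I t - w 0 = (x' t - w 0 * I t) / I t"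
        using I by (simp add: field_simps)
      ultimately show ?case using I by (simp add: dist_real_def field_simps)
    qed
  qed

  have ratio_pos: "\<forall>\<^sub>F t in at_left T. x' t / I t > 0"
    using order_tendstoD(1)[OF ratio w0] .
  have x'_pos: "\<forall>\<^sub>F t in at_left T. x' t > 0"
    using ratio_pos I_large[of 0] by eventually_elim (simp add: zero_less_divide_iff)
  have F_deriv_x: "((\<lambda>t. F (x t)) has_real_derivative q t * x' t) (at t)" if "0 < t" "t < T" for t
    using DERIV_chain2[OF F_deriv[OF x_pos] x_deriv] that by (simp add: q_def)
  have sq: "((\<lambda>t. (I t)\<^sup>2 / F (x t)) \<longlongrightarrow> 2 / w 0) (at_left T)"
  proof (rule lhopital_left_at_top[where f' = "\<lambda>t. 2 * I t * q t" and g' = "\<lambda>t. q t * x' t"])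
    show "filterlim (\<lambda>t. F (x t)) at_top (at_left T)"
      by (rule filterlim_compose[OF F_at_top blow])
    show "\<forall>\<^sub>F t in at_left T. q t * x' t \<noteq> 0"
      using x'_pos ev[OF \<open>T > 0\<close>]
    proof eventually_elim
      case (elim t)
      then show ?case using q_pos[of t] by simp
    qed
    show "\<forall>\<^sub>F t in at_left T. ((\<lambda>t. (I t)\<^sup>2) has_real_derivative 2 * I t * q t) (at t)"
      using ev[OF \<open>T > 0\<close>] by eventually_elim (auto intro!: derivative_eq_intros I_deriv)
    show "\<forall>\<^sub>F t in at_left T. ((\<lambda>t. F (x t)) has_real_derivative q t * x' t) (at t)"
      using ev[OF \<open>T > 0\<close>] by eventually_elim (auto intro!: F_deriv_x)
    have "((\<lambda>t. 2 / (x' t / I t)) \<longlongrightarrow> 2 / w 0) (at_left T)"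
      using w0 by (intro tendsto_intros ratio) auto
    moreover have "\<forall>\<^sub>F t in at_left T. 2 / (x' t / I t) = 2 * I t * q t / (q t * x' t)"
      using ev[OF \<open>T > 0\<close>]
    proof eventually_elim
      case (elim t)
      then show ?case using q_pos[of t] by (simp add: field_simps)
    qed
    ultimately show "((\<lambda>t. 2 * I t * q t / (q t * x' t)) \<longlongrightarrow> 2 / w 0) (at_left T)"
      by (rule Lim_transform_eventually)
  qed
  have "((\<lambda>t. x' t / I t * sqrt ((I t)\<^sup>2 / F (x t))) \<longlongrightarrow> w 0 * sqrt (2 / w 0)) (at_left T)"
    by (intro tendsto_intros ratio sq)
  moreover have "w 0 * sqrt (2 / w 0) = sqrt (2 * w 0)"
  proof -
    have "w 0 * sqrt (2 / w 0) = sqrt ((w 0)\<^sup>2) * sqrt (2 / w 0)" using w0 by simp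
    also have "\<dots> = sqrt (2 * w 0)"
      unfolding real_sqrt_mult[symmetric] using w0 by (simp add: power2_eq_square)
    finally show ?thesis .
  qed
  \<comment> \<open>As \<open>I t > 0\<close>, the square root cancels \<open>I t\<close> and leaves
    \<open>x' t / sqrt (F (x t))\<close>. It is written as the quotient of the derivatives of
    \<open>FB f (x t)\<close> and \<open>T - t\<close>.\<close>
  moreover have "\<forall>\<^sub>F t in at_left T. x' t / I t * sqrt ((I t)\<^sup>2 / F (x t)) = - k (x t) * x' t / - 1"
    using I_large[of 0] by eventually_elim (simp add: real_sqrt_divide)
  ultimately have "((\<lambda>t. - k (x t) * x' t / - 1) \<longlongrightarrow> sqrt (2 * w 0)) (at_left T)"
    using Lim_transform_eventually by fastforce
  then show ?thesis
  proof (rule lhopital_left[where f' = "\<lambda>t. - k (x t) * x' t" and g' = "\<lambda>_. - 1", rotated -1])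
    show "((\<lambda>t. FB f (x t)) \<longlongrightarrow> 0) (at_left T)"
      by (rule filterlim_compose[OF FB_tendsto_0 blow])
    show "((\<lambda>t. T - t) \<longlongrightarrow> 0) (at_left T)"
      by (auto intro!: tendsto_eq_intros)
    show "\<forall>\<^sub>F t in at_left T. T - t \<noteq> 0"
      using ev[OF \<open>T > 0\<close>] by eventually_elim auto
    show "\<forall>\<^sub>F t in at_left T. ((\<lambda>t. FB f (x t)) has_real_derivative - k (x t) * x' t) (at t)"
      using ev[OF \<open>T > 0\<close>]
    proof eventually_elim
      case (elim t)
      then show ?case by (intro DERIV_chain2[OF FB_deriv[OF x_pos] x_deriv]) auto
    qed
    show "\<forall>\<^sub>F t in at_left T. ((\<lambda>t. T - t) has_real_derivative - 1) (at t)"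
      by (auto intro!: always_eventually derivative_eq_intros)
  qed auto
qed

subsection \<open>Behaviour at a finite maximal time\<close>

text \<open>\<open>x - H\<close> is nondecreasing and bounded, so \<open>x\<close> has a limit at
  \<open>T\<close>. With this value added, the solution ranges in a compact part of the positive
  axis. Truncating \<open>f\<close> outside a neighbourhood of it makes the continuation theorem
  applicable, and for a short time the continuation does not notice the truncation.\<close>

lemma bounded_solution_extends:
  assumes sol: "\<And>b. 0 \<le> b \<Longrightarrow> b < T \<Longrightarrow> solves x b" and "T > 0"
    and bounded: "\<And>t. 0 \<le> t \<Longrightarrow> t < T \<Longrightarrow> x t - H t \<le> Z"
  shows "\<exists>y T'. T < T' \<and> is_solution h w f \<psi> y (ereal T') \<and> (\<forall>t. 0 \<le> t \<and> t < T \<longrightarrow> y t = x t)"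
proof -
  define L where "L = (SUP t\<in>{0..<T}. x t - H t)"
  have bdd: "bdd_above ((\<lambda>t. x t - H t) ` {0..<T})"
    using bounded by (auto intro!: bdd_aboveI2[where M = Z])
  have le_L: "x t - H t \<le> L" if "0 \<le> t" "t < T" for t
    unfolding L_def using that by (intro cSUP_upper bdd) auto
  have "((\<lambda>t. x t - H t) \<longlongrightarrow> L) (at_left T)"
  proof (rule increasing_tendsto)
    have ev: "\<forall>\<^sub>F t in at_left T. a < t \<and> t < T" if "a < T" for a
      using that by (auto simp: eventually_at_left_field)
    show "\<forall>\<^sub>F t in at_left T. x t - H t \<le> L"
      using ev[OF \<open>T > 0\<close>] by eventually_elim (auto intro!: le_L)
    show "\<forall>\<^sub>F t in at_left T. l < x t - H t" if "l < L" for l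
    proof -
      obtain s where s: "s \<in> {0..<T}" "l < x s - H s"
        using \<open>l < L\<close> \<open>T > 0\<close> bdd unfolding L_def by (subst (asm) less_cSUP_iff) auto
      then have "s < T" by simp
      from ev[OF this] show ?thesis
      proof eventually_elim
        case (elim t)
        then show ?case using solution_minus_H_mono[OF sol[of t], of s t] s by simp
      qed
    qed
  qed
  moreover have "(H \<longlongrightarrow> H T) (at_left T)"
    using continuous_on_Icc_at_leftD[OF H_continuous \<open>T > 0\<close>] .
  ultimately have x_lim: "(x \<longlongrightarrow> L + H T) (at_left T)"
    using tendsto_add by fastforce

  define x1 where "x1 t = (if t < T then x t else L + H T)" for t
  have x1_deriv: "(x1 has_real_derivative h t + conv w (\<lambda>s. f (x1 s)) t) (at t)" if t: "0 < t" "t < T" for t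
  proof -
    have "solves x ((t + T) / 2)" using t by (intro sol) auto
    then have "(x has_real_derivative h t + conv w (\<lambda>s. f (x s)) t) (at t)"
      by (rule solvesD(3)) (use t in auto)
    moreover have "conv w (\<lambda>s. f (x s)) t = conv w (\<lambda>s. f (x1 s)) t"
      using t by (intro conv_cong) (auto simp: x1_def)
    ultimately have "(x has_real_derivative h t + conv w (\<lambda>s. f (x1 s)) t) (at t)" by simp
    then show ?thesis
      by (rule has_field_derivative_transform_within_open[where S = "{..<T}"]) (use t in \<open>auto simp: x1_def\<close>)
  qed
  have x1_cont: "continuous_on {0..T} x1"
  proof (rule continuous_on_IccI)
    have "continuous_on {0..T/2} x" using solvesD(2)[OF sol[of "T / 2"]] \<open>T > 0\<close> by simp
    then have "(x \<longlongrightarrow> x1 0) (at_right 0)"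
      using continuous_on_Icc_at_rightD[of 0 "T / 2" x] \<open>T > 0\<close> by (simp add: x1_def)
    moreover have "\<forall>\<^sub>F t in at_right 0. x t = x1 t"
      using eventually_at_right_less \<open>T > 0\<close> by (auto simp: eventually_at_right_field x1_def)
    ultimately show "(x1 \<longlongrightarrow> x1 0) (at_right 0)" by (rule Lim_transform_eventually)
    have "\<forall>\<^sub>F t in at_left T. x t = x1 t"
      by (auto simp: eventually_at_left_field x1_def intro: exI[of _ "T - 1"])
    then show "(x1 \<longlongrightarrow> x1 T) (at_left T)"
      using Lim_transform_eventually[OF x_lim] by (simp add: x1_def)
    show "x1 \<midarrow>t\<rightarrow> x1 t" if "0 < t" "t < T" for t
      using DERIV_isCont[OF x1_deriv[OF that]] by (simp add: isCont_def)
  qed (fact \<open>T > 0\<close>)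
  have x1_ge: "\<psi> \<le> x1 t" if "t \<in> {0..T}" for t
  proof (cases "t < T")
    case True
    then show ?thesis using solution_ge_psi[OF sol[of t], of t] that by (simp add: x1_def)
  next
    case False
    have "\<psi> \<le> L" using le_L[of 0] solvesD(1)[OF sol[of 0]] \<open>T > 0\<close> by simp
    then show ?thesis using False H_nonneg[of T] \<open>T > 0\<close> by (simp add: x1_def)
  qed

  have "compact (x1 ` {0..T})" by (intro compact_continuous_image x1_cont) simp
  then obtain R where R: "\<And>t. t \<in> {0..T} \<Longrightarrow> \<bar>x1 t\<bar> \<le> R"
    by (metis compact_imp_bounded bounded_iff image_eqI real_norm_def)
  \<comment> \<open>\<open>x1\<close> takes values in \<open>{\<psi>..R}\<close>; the cut-offs leave
    a margin of \<open>\<psi> / 2\<close> below and 1 above, so that \<open>g\<close> and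
    \<open>f\<close> still agree shortly after \<open>T\<close>.\<close>
  define g where "g u = f (max (\<psi> / 2) (min (R + 1) u))" for u
  have "R \<ge> \<psi>" using R[of 0] x1_ge[of 0] \<open>T > 0\<close> by simp
  have g_eq: "g u = f u" if "\<psi> / 2 \<le> u" "u \<le> R + 1" for u
    using that by (simp add: g_def max_def min_def)
  have g_cont: "continuous_on UNIV g"
    unfolding g_def by (intro f_comp_continuous continuous_intros) (use psi_pos in auto)
  have "compact (f ` {\<psi> / 2..R + 1})"
    using psi_pos by (intro compact_continuous_image continuous_on_subset[OF f_cont]) auto
  then obtain B where B: "\<And>u. u \<in> {\<psi> / 2..R + 1} \<Longrightarrow> \<bar>f u\<bar> \<le> B"
    by (metis compact_imp_bounded bounded_iff image_eqI real_norm_def)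
  have g_bound: "\<bar>g u\<bar> \<le> B" for u
    unfolding g_def using \<open>R \<ge> \<psi>\<close> psi_pos by (intro B) auto
  have x1_eq: "x1 t = \<psi> + integral {0..t} (\<lambda>r. h r + conv w (\<lambda>s. g (x1 s)) r)" if t: "t \<in> {0..T}" for t
  proof -
    have "((\<lambda>r. h r + conv w (\<lambda>s. f (x1 s)) r) has_integral x1 t - x1 0) {0..t}"
    proof (rule fundamental_theorem_of_calculus_interior)
      show "(x1 has_vector_derivative h r + conv w (\<lambda>s. f (x1 s)) r) (at r)" if "r \<in> {0<..<t}" for r
        using x1_deriv[of r] that t by (simp add: has_real_derivative_iff_has_vector_derivative)
    qed (use t in \<open>auto intro: continuous_on_subset[OF x1_cont]\<close>)
    moreover have "integral {0..t} (\<lambda>r. h r + conv w (\<lambda>s. f (x1 s)) r)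
        = integral {0..t} (\<lambda>r. h r + conv w (\<lambda>s. g (x1 s)) r)"
    proof (intro integral_cong arg_cong2[where f = "(+)"] refl conv_cong)
      fix r s assume "r \<in> {0..t}" "s \<in> {0..r}"
      then have "s \<in> {0..T}" using t by auto
      then show "f (x1 s) = g (x1 s)" using x1_ge[of s] R[of s] psi_pos by (intro g_eq[symmetric]) auto
    qed
    ultimately show ?thesis
      using solvesD(1)[OF sol[of 0]] \<open>T > 0\<close> by (simp add: x1_def integral_unique)
  qed

  obtain z where z: "continuous_on {0..T + 1} z"
    "\<And>t. t \<in> {0..T + 1} \<Longrightarrow> z t = \<psi> + integral {0..t} (\<lambda>r. h r + conv w (\<lambda>s. g (z s)) r)"
    "\<And>t. t \<in> {0..T} \<Longrightarrow> z t = x1 t"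
    by (rule volterra_continuation[of T w h g B x1 \<psi>])
      (use \<open>T > 0\<close> w_cont continuous_on_subset[OF h_cont] g_cont g_bound x1_cont x1_eq in auto)
  \<comment> \<open>The smaller of the two margins is the tolerance in the continuity of
    \<open>z\<close> at \<open>T\<close>.\<close>
  have "T \<in> {0..T + 1}" "min (\<psi> / 2) 1 > 0" using \<open>T > 0\<close> psi_pos by auto
  then obtain \<delta> where \<delta>: "\<delta> > 0" "\<And>t. t \<in> {0..T + 1} \<Longrightarrow> dist t T < \<delta> \<Longrightarrow> dist (z t) (z T) < min (\<psi> / 2) 1"
    using z(1) unfolding continuous_on_iff by blast
  define T' where "T' = T + min \<delta> 1"
  have T': "T < T'" "T' \<le> T + 1" "T' \<le> T + \<delta>" using \<delta>(1) by (auto simp: T'_def)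
  have g_z: "g (z t) = f (z t)" if "0 \<le> t" "t < T'" for t
  proof (rule g_eq)
    have "z T = x1 T" using z(3) \<open>T > 0\<close> by simp
    have "\<bar>z t - x1 t'\<bar> < min (\<psi> / 2) 1" if "t' = min t T" for t'
    proof (cases "t \<le> T")
      case True
      then show ?thesis using z(3)[of t] \<open>0 \<le> t\<close> psi_pos that by auto
    next
      case False
      then show ?thesis using \<delta>(2)[of t] \<open>t < T'\<close> T' \<open>0 \<le> t\<close> \<open>z T = x1 T\<close> that by (auto simp: dist_real_def)
    qed
    from this[OF refl] have "\<bar>z t - x1 (min t T)\<bar> < \<psi> / 2" "\<bar>z t - x1 (min t T)\<bar> < 1" by simp_all
    moreover have "\<psi> \<le> x1 (min t T)" "\<bar>x1 (min t T)\<bar> \<le> R"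
      using x1_ge[of "min t T"] R[of "min t T"] \<open>0 \<le> t\<close> \<open>T > 0\<close> by auto
    ultimately show "\<psi> / 2 \<le> z t" "z t \<le> R + 1" by linarith+
  qed
  have dom: "{t. 0 \<le> t \<and> ereal t < ereal T'} = {0..<T'}" by auto
  have "is_solution h w f \<psi> z (ereal T')"
    unfolding is_solution_def dom
  proof (intro conjI allI impI)
    show "0 < ereal T'" using \<open>T > 0\<close> T' by simp
    show "z 0 = \<psi>" using z(2)[of 0] \<open>T > 0\<close> by simp
    show "continuous_on {0..<T'} z" using T' by (intro continuous_on_subset[OF z(1)]) auto
    fix t assume "0 \<le> t \<and> ereal t < ereal T'"
    then have t: "t \<in> {0..<T'}" by simp
    have "continuous_on {0..T + 1} (\<lambda>r. h r + conv w (\<lambda>s. g (z s)) r)"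
      by (intro continuous_on_add conv_continuous w_cont continuous_on_subset[OF h_cont]
          continuous_on_compose2[OF g_cont z(1)]) auto
    then have "((\<lambda>t. \<psi> + integral {0..t} (\<lambda>r. h r + conv w (\<lambda>s. g (z s)) r)) has_real_derivative
        h t + conv w (\<lambda>s. g (z s)) t) (at t within {0..T + 1})"
      using t T' by (auto intro!: derivative_eq_intros integral_has_real_derivative)
    then have "(z has_real_derivative h t + conv w (\<lambda>s. g (z s)) t) (at t within {0..T + 1})"
      by (rule has_field_derivative_transform_within[OF _ zero_less_one]) (use t T' z(2) in auto)
    then have "(z has_real_derivative h t + conv w (\<lambda>s. g (z s)) t) (at t within {0..<T'})"
      by (rule DERIV_subset) (use T' in auto)
    moreover have "conv w (\<lambda>s. g (z s)) t = conv w (\<lambda>s. f (z s)) t"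
      using t by (intro conv_cong g_z) auto
    ultimately show "(z has_real_derivative h t + integral {0..t} (\<lambda>s. w (t - s) * f (z s))) (at t within {0..<T'})"
      by (simp add: conv_def)
  qed
  moreover have "z t = x t" if "0 \<le> t" "t < T" for t
    using z(3)[of t] that by (simp add: x1_def)
  ultimately show ?thesis using T' by blast
qed

text \<open>A large value of the nondecreasing \<open>x - H\<close> persists, and
  \<open>x \<ge> x - H\<close> because \<open>H\<close> is nonnegative.\<close>

lemma unbounded_solution_at_top:
  assumes sol: "\<And>b. 0 \<le> b \<Longrightarrow> b < T \<Longrightarrow> solves x b"
    and unbounded: "\<And>Z. \<exists>t. 0 \<le> t \<and> t < T \<and> Z < x t - H t"
  shows "filterlim x at_top (at_left T)"
  unfolding filterlim_at_top
proof
  fix Z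
  obtain s where s: "0 \<le> s" "s < T" "Z < x s - H s" using unbounded by blast
  have "Z \<le> x t" if t: "s < t" "t < T" for t
    using solution_minus_H_mono[OF sol[of t], of s t] H_nonneg[of t] s t by simp
  then show "\<forall>\<^sub>F t in at_left T. Z \<le> x t"
    using s(2) by (auto simp: eventually_at_left_field)
qed

end

theorem theorem4p1:
  fixes f w h x :: "real \<Rightarrow> real" and \<psi> :: real and T :: ereal
  assumes f_cont: "continuous_on {0<..} f"
    and f_pos: "\<forall>u>0. f u > 0"
    and f_asymp: "asymp_increasing f"
    and f_superlin: "filterlim (\<lambda>u. f u / u) at_top at_top"
    and w_cont: "continuous_on {0..} w"
    and w_nonneg: "\<forall>t\<ge>0. w t \<ge> 0"
    and w0: "w 0 > 0"
    and h_cont: "continuous_on UNIV h"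
    and H_nonneg: "\<forall>t\<ge>0. integral {0..t} h \<ge> 0"
    and psi_pos: "\<psi> > 0"
    and f_int: "\<forall>u>0. f integrable_on {0..u}"
    and osgood: "\<exists>\<eta>>0. (\<lambda>u. 1 / sqrt (integral {0..u} f)) integrable_on {\<eta>..}"
    and sol: "is_maximal_solution h w f \<psi> x T"
  shows "(\<exists>Tr::real. T = ereal Tr \<and> filterlim (\<lambda>t. \<bar>x t\<bar>) at_top (at_left Tr)) \<and>
         ((preserves_superexp f \<and> strict_mono_on {0<..} f) \<longrightarrow>
            (\<forall>Tr::real. T = ereal Tr \<longrightarrow>
               ((\<lambda>t. FB f (x t) / (Tr - t)) \<longlongrightarrow> sqrt (2 * w 0)) (at_left Tr)))"
proof -
  interpret volterra f w h \<psi>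
    by unfold_locales (use assms in auto)
  let ?D = "{t. 0 \<le> t \<and> ereal t < T}"
  have is_sol: "is_solution h w f \<psi> x T"
    and maximal: "\<And>y T'. T < T' \<Longrightarrow> is_solution h w f \<psi> y T' \<Longrightarrow> \<exists>t. 0 \<le> t \<and> ereal t < T \<and> y t \<noteq> x t"
    using sol unfolding is_maximal_solution_def by auto
  have solves: "solves x b" if "0 \<le> b" "ereal b < T" for b
    unfolding solves_def
  proof (intro conjI ballI)
    have sub: "{0..b} \<subseteq> ?D" using that by (auto intro: le_less_trans[of "ereal _" "ereal b"])
    show "x 0 = \<psi>" using is_sol by (simp add: is_solution_def)
    show "continuous_on {0..b} x"
      using is_sol sub by (auto simp: is_solution_def intro: continuous_on_subset)
    fix t assume t: "t \<in> {0<..<b}"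
    then have "t \<in> ?D" by (intro subsetD[OF sub]) auto
    then have "(x has_real_derivative h t + conv w (\<lambda>s. f (x s)) t) (at t within ?D)"
      using is_sol by (simp add: is_solution_def conv_def)
    then have "(x has_real_derivative h t + conv w (\<lambda>s. f (x s)) t) (at t within {0<..<b})"
      by (rule DERIV_subset) (use sub in \<open>auto simp: subset_eq\<close>)
    then show "(x has_real_derivative h t + conv w (\<lambda>s. f (x s)) t) (at t)"
      using at_within_open[OF t] by simp
  qed
  \<comment> \<open>An infinite \<open>T\<close> would make \<open>x\<close> a solution on every
    \<open>{0..b}\<close>.\<close>
  have "T \<noteq> \<infinity>"
    using no_global_solution[OF solves f_asymp] by auto
  moreover have "0 < T" using is_sol by (simp add: is_solution_def)
  ultimately obtain Tr where Tr: "T = ereal Tr" "Tr > 0"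
    by (cases T) auto
  have top: "filterlim x at_top (at_left Tr)"
  proof (rule unbounded_solution_at_top)
    show "\<exists>t. 0 \<le> t \<and> t < Tr \<and> Z < x t - H t" for Z
    \<comment> \<open>A bound on \<open>x - H\<close> would give an extension beyond
      \<open>Tr\<close>, against maximality.\<close>
    proof (rule ccontr)
      assume "\<not> ?thesis"
      then have "x t - H t \<le> Z" if "0 \<le> t" "t < Tr" for t
        using that by (meson not_less)
      then obtain y T' where "Tr < T'" "is_solution h w f \<psi> y (ereal T')"
          "\<forall>t. 0 \<le> t \<and> t < Tr \<longrightarrow> y t = x t"
        using bounded_solution_extends[of Tr x Z] solves Tr by auto
      then show False using maximal[of "ereal T'" y] Tr by auto
    qed
  qed (use solves Tr in auto)
  have "filterlim (\<lambda>t. \<bar>x t\<bar>) at_top (at_left Tr)"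
    by (rule filterlim_at_top_mono[OF top always_eventually]) (simp add: abs_ge_self)
  moreover have "((\<lambda>t. FB f (x t) / (Tr - t)) \<longlongrightarrow> sqrt (2 * w 0)) (at_left Tr)"
    using blow_up_rate[OF _ Tr(2) top] solves Tr by simp
  ultimately show ?thesis using Tr by auto
qed

end
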